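(* Let $S_t=S_0e^{X_t}$, $S_0>0$, where $X$ is a CGMY process under $\mathbb{P}$ with parameters $C,G>0$, $M>1$ and $Y\in(1,2)$, such that $(S_t)$ is a $\mathbb{P}$-martingale. Then the at-the-money call option price satisfies $$\lim_{t\to0}t^{-1/Y}\,\mathbb{E}(S_t-S_0)_+=S_0\,\mathbb{E}^*(Z_+),$$ where $Z$ is, under $\mathbb{P}^*$, a symmetric $Y$-stable random variable with characteristic function $\zeta(u)=\exp\big(-2C\,\Gamma(-Y)\,|\cos(\tfrac12Y\pi)|\,|u|^Y\big)$, and $\mathbb{E}^*$ is expectation under $\mathbb{P}^*$.
   Context: A CGMY process is a pure-jump Lévy process (no Gaussian component) with Lévy density $\nu(x)=Ce^{-Mx}x^{-1-Y}1_{\{x>0\}}+Ce^{Gx}|x|^{-1-Y}1_{\{x<0\}}$; for $Y\ne1$ its characteristic function is $\mathbb{E}e^{iuX_t}=\exp\big[tC\Gamma(-Y)\{(M-iu)^Y+(G+iu)^Y-M^Y-G^Y\}+i\hat b ut\big]$ for some $\hat b\in\mathbb{R}$; here $\hat b$ is fixed by the martingale condition $\mathbb{E}e^{X_t}=1$. Interest rate and dividends are zero. $\mathbb{P}^*$ is the share measure, $\mathbb{P}^*(B)=\mathbb{E}(e^{X_t}1_B)$ for $B\in\mathcal F_t$; only the law of $Z$ matters in the statement. $z_+=\max(z,0)$. *)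

theory Defs
  imports "HOL-Probability.Probability"
begin

text \<open>Processes are indexed by \<^typ>\<open>real\<close>, but only times \<open>t \<ge> 0\<close> are ever constrained.\<close>

definition cadlag :: "(real \<Rightarrow> real) \<Rightarrow> bool" where
  "cadlag f \<longleftrightarrow>
     (\<forall>t\<ge>0. continuous (at_right t) f) \<and>
     (\<forall>t>0. \<exists>l. (f \<longlongrightarrow> l) (at_left t))"

definition levy_process :: "'a measure \<Rightarrow> (real \<Rightarrow> 'a \<Rightarrow> real) \<Rightarrow> bool" where
  "levy_process P X \<longleftrightarrow>
     prob_space P \<and>
     (\<forall>t\<ge>0. X t \<in> borel_measurable P) \<and>
     (AE \<omega> in P. X 0 \<omega> = 0) \<and>
     (\<forall>(n::nat) (s::nat \<Rightarrow> real). 0 \<le> s 0 \<and> (\<forall>i<n. s i \<le> s (Suc i)) \<longrightarrow>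
        prob_space.indep_vars P (\<lambda>_. borel) (\<lambda>i \<omega>. X (s (Suc i)) \<omega> - X (s i) \<omega>) {..<n}) \<and>
     (\<forall>s t. 0 \<le> s \<and> s \<le> t \<longrightarrow>
        distr P borel (\<lambda>\<omega>. X t \<omega> - X s \<omega>) = distr P borel (X (t - s))) \<and>
     (\<forall>t\<ge>0. \<forall>\<epsilon>>0.
        ((\<lambda>s. measure P {\<omega> \<in> space P. \<bar>X s \<omega> - X t \<omega>\<bar> > \<epsilon>}) \<longlongrightarrow> 0) (at t within {0..})) \<and>
     (AE \<omega> in P. cadlag (\<lambda>t. X t \<omega>))"

definition levy_measure :: "real measure \<Rightarrow> bool" where
  "levy_measure \<nu> \<longleftrightarrow>
     sets \<nu> = sets borel \<and> emeasure \<nu> {0} = 0 \<and> integrable \<nu> (\<lambda>x. min 1 (x\<^sup>2))"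

text \<open>The L\'evy--Khintchine exponent with drift \<open>b\<close>, Gaussian variance \<open>v\<close>, L\'evy measure
  \<open>\<nu>\<close> and truncation function \<open>x \<mapsto> x 1\<^bsub>\<bar>x\<bar> \<le> 1\<^esub>\<close>.\<close>

definition levy_exponent :: "real \<Rightarrow> real \<Rightarrow> real measure \<Rightarrow> real \<Rightarrow> complex" where
  "levy_exponent b v \<nu> u =
     \<i> * complex_of_real (b * u) - complex_of_real (v * u\<^sup>2 / 2) +
     integral\<^sup>L \<nu> (\<lambda>x. iexp (u * x) - 1 - \<i> * complex_of_real (u * x * indicator {-1..1} x))"

definition has_levy_triplet ::
    "'a measure \<Rightarrow> (real \<Rightarrow> 'a \<Rightarrow> real) \<Rightarrow> real \<Rightarrow> real \<Rightarrow> real measure \<Rightarrow> bool" where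
  "has_levy_triplet P X b v \<nu> \<longleftrightarrow>
     levy_measure \<nu> \<and> v \<ge> 0 \<and>
     (\<forall>t\<ge>0. \<forall>u. char (distr P borel (X t)) u = exp (complex_of_real t * levy_exponent b v \<nu> u))"

definition cgmy_density :: "real \<Rightarrow> real \<Rightarrow> real \<Rightarrow> real \<Rightarrow> real \<Rightarrow> real" where
  "cgmy_density C G M Y x =
     (if x > 0 then C * exp (- M * x) * x powr (- 1 - Y)
      else if x < 0 then C * exp (G * x) * \<bar>x\<bar> powr (- 1 - Y)
      else 0)"

text \<open>The drift is left free here; for \<open>M > 1\<close> it is determined as soon as \<open>exp (X t)\<close> is required
  to be a martingale.\<close>

definition cgmy_process ::
    "'a measure \<Rightarrow> real \<Rightarrow> real \<Rightarrow> real \<Rightarrow> real \<Rightarrow> (real \<Rightarrow> 'a \<Rightarrow> real) \<Rightarrow> bool" where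
  "cgmy_process P C G M Y X \<longleftrightarrow>
     levy_process P X \<and>
     (\<exists>b. has_levy_triplet P X b 0 (density lborel (\<lambda>x. ennreal (cgmy_density C G M Y x))))"

definition martingale ::
    "'a measure \<Rightarrow> (real \<Rightarrow> 'a measure) \<Rightarrow> (real \<Rightarrow> 'a \<Rightarrow> real) \<Rightarrow> bool" where
  "martingale P F S \<longleftrightarrow>
     (\<forall>t\<ge>0. subalgebra P (F t)) \<and>
     (\<forall>s t. 0 \<le> s \<and> s \<le> t \<longrightarrow> sets (F s) \<subseteq> sets (F t)) \<and>
     (\<forall>t\<ge>0. S t \<in> borel_measurable (F t) \<and> integrable P (S t)) \<and>
     (\<forall>s t. 0 \<le> s \<and> s \<le> t \<longrightarrow> (AE \<omega> in P. real_cond_exp P (F s) (S t) \<omega> = S s \<omega>))"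

end

theory Submission
  imports Defs "HOL-Real_Asymp.Real_Asymp"
begin

text \<open>Since \<open>\<E> S\<^sub>t = S\<^sub>0\<close>, the call price equals the put price \<open>\<E> (S\<^sub>0 - S\<^sub>t)\<^sub>+\<close>, whose payoff is bounded, so
  that no exponential moment has to be controlled and no change of measure is needed.
  With \<open>h = t\<^bsup>1/Y\<^esup>\<close>, scaling the jump integral shows that the characteristic function of \<open>W = X\<^sub>t / h\<close>
  tends to that of \<open>Z\<close>; the drift contributes only \<open>O(h\<^bsup>Y-1\<^esup>)\<close>. The exponent is
  \<open>O(\<bar>u\<bar> + \<bar>u\<bar>\<^bsup>Y\<^esup>)\<close>, and averaging the characteristic function against a Gaussian turns this into
  \<open>\<P>(\<bar>W\<bar> \<ge> y) \<le> A y\<^bsup>-Y\<^esup>\<close> for \<open>y < 1/h\<close>. As the rescaled put payoff is at most \<open>min W\<^sub>- (1/h)\<close> and \<open>Y > 1\<close>,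
  this dominates its tail probabilities, whose integral thus converges to \<open>\<E> Z\<^sub>- = \<E> Z\<^sub>+\<close>.\<close>

subsection \<open>The stable exponent\<close>

text \<open>Euler's integral for \<open>Gamma (b / p)\<close> under the substitution
  \<open>t = r * s powr p\<close>.\<close>

lemma nn_integral_Gamma_power:
  fixes b p r :: real
  assumes "b > 0" "p > 0" "r > 0"
  shows "(\<integral>\<^sup>+s\<in>{0<..}. ennreal (s powr (b - 1) * exp (- r * s powr p)) \<partial>lborel)
    = ennreal (Gamma (b / p) / (p * r powr (b / p)))"
proof -
  define f where "f = (\<lambda>t::real. t powr (b / p - 1) / exp t)"
  define g where "g = (\<lambda>s::real. r * s powr p)"
  define g' where "g' = (\<lambda>s::real. r * (p * s powr (p - 1)))"
  have img: "g ` {0<..} = {0<..}"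
  proof (intro equalityI subsetI)
    fix y :: real assume "y \<in> {0<..}"
    then have "y = g ((y / r) powr (1 / p))" "(y / r) powr (1 / p) > 0"
      using assms by (auto simp: g_def powr_powr)
    then show "y \<in> g ` {0<..}" by blast
  qed (use assms in \<open>auto simp: g_def\<close>)
  have inj: "inj_on g {0<..}"
  proof (rule inj_onI)
    fix x y assume "x \<in> {0<..}" "y \<in> {0<..}" "g x = g y"
    then have "(x powr p) powr (1 / p) = (y powr p) powr (1 / p)"
      using assms by (simp add: g_def)
    then show "x = y"
      using assms \<open>x \<in> {0<..}\<close> \<open>y \<in> {0<..}\<close> by (simp add: powr_powr)
  qed
  \<comment> \<open>The endpoint 0 is dropped so that the substitution becomes a differentiable
    bijection between open half-lines.\<close>
  have f0: "(f has_integral Gamma (b / p)) {0<..}"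
  proof -
    have *: "(f has_integral Gamma (b / p)) {0..}"
      unfolding f_def using Gamma_integral_real[of "b / p"] assms by simp
    show ?thesis
      by (subst has_integral_spike_set_eq[OF _ _, of _ "{0..}"])
         (use * in \<open>auto intro!: negligible_subset[OF negligible_sing[of 0]]\<close>)
  qed
  have "f absolutely_integrable_on {0<..} \<and> integral {0<..} f = Gamma (b / p)"
    using f0 by (auto intro!: nonnegative_absolutely_integrable_1 simp: f_def integral_unique
       has_integral_integrable)
  then have "(\<lambda>x. \<bar>g' x\<bar> * f (g x)) absolutely_integrable_on {0<..} \<and>
      integral {0<..} (\<lambda>x. \<bar>g' x\<bar> * f (g x)) = Gamma (b / p)"
    by (subst has_absolute_integral_change_of_variables_1'[OF _ _ inj])
       (auto simp: img g'_def intro!: derivative_eq_intros, auto simp: g_def intro!: derivative_eq_intros)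
  then have *: "((\<lambda>x. \<bar>g' x\<bar> * f (g x)) has_integral Gamma (b / p)) {0<..}"
    by (metis has_integral_integral set_lebesgue_integral_eq_integral(1))
  \<comment> \<open>The exponents add up as \<open>(p - 1) + p * (b / p - 1) = b - 1\<close>, and
    the factor \<open>r\<close> of the derivative raises the power of \<open>r\<close> to
    \<open>b / p\<close>.\<close>
  have eq: "\<bar>g' s\<bar> * f (g s) / (p * r powr (b / p)) = s powr (b - 1) * exp (- r * s powr p)" if "s > 0" for s
  proof -
    have "r * r powr (b / p - 1) = r powr (b / p)"
      using assms by (simp add: powr_diff)
    moreover have "s powr (p - 1) * (s powr p) powr (b / p - 1) = s powr (b - 1)"
      using assms that by (simp add: powr_powr powr_add[symmetric] right_diff_distrib)
    moreover have "\<bar>g' s\<bar> * f (g s) = p * (r * r powr (b / p - 1)) *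
       (s powr (p - 1) * (s powr p) powr (b / p - 1)) * exp (- r * s powr p)"
      using assms that by (simp add: g'_def f_def g_def exp_minus field_simps powr_mult)
    ultimately show ?thesis using assms by simp
  qed
  have "((\<lambda>s. s powr (b - 1) * exp (- r * s powr p)) has_integral Gamma (b / p) / (p * r powr (b / p))) {0<..}"
    by (rule has_integral_eq[OF _ has_integral_divide[OF *]]) (simp add: eq)
  from nn_integral_has_integral_lebesgue[OF _ this] show ?thesis
    unfolding nn_integral_set_ennreal by (simp add: mult.commute)
qed

text \<open>The integrand has an elementary antiderivative that vanishes at infinity; its value at 0
  contributes \<open>1 / s - s / (1 + s\<^sup>2)\<close>.\<close>

lemma Laplace_one_minus_cos:
  fixes s :: real
  assumes "s > 0"
  shows "(\<integral>\<^sup>+x\<in>{0<..}. ennreal ((1 - cos x) * exp (- s * x)) \<partial>lborel) = ennreal (1 / (s * (1 + s\<^sup>2)))"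
proof -
  define F where "F = (\<lambda>x. - exp (- s * x) / s + exp (- s * x) * (s * cos x - sin x) / (1 + s\<^sup>2))"
  have nz: "1 + s\<^sup>2 \<noteq> 0" "s \<noteq> 0" by (smt (verit) zero_le_power2) (use assms in simp)
  have "(\<integral>\<^sup>+x\<in>{0<..}. ennreal ((1 - cos x) * exp (- s * x)) \<partial>lborel)
      = (\<integral>\<^sup>+x\<in>{0..}. ennreal ((1 - cos x) * exp (- s * x)) \<partial>lborel)"
    by (intro nn_integral_cong_AE AE_I[of _ _ "{0}"]) (auto simp: indicator_def)
  also have "\<dots> = ennreal (0 - F 0)"
  proof (rule nn_integral_FTC_atLeast)
    fix x :: real assume "0 \<le> x"
    have e: "((\<lambda>x. exp (- s * x)) has_real_derivative - s * exp (- s * x)) (at x)"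
      by (auto intro!: derivative_eq_intros)
    have d: "((\<lambda>x. exp (- s * x) * (s * cos x - sin x)) has_real_derivative
        - exp (- s * x) * cos x * (1 + s\<^sup>2)) (at x)"
      by (auto intro!: derivative_eq_intros simp: algebra_simps power2_eq_square)
    show "(F has_real_derivative (1 - cos x) * exp (- s * x)) (at x)"
      using DERIV_add[OF DERIV_cdivide[OF DERIV_minus[OF e], of s] DERIV_cdivide[OF d, of "1 + s\<^sup>2"]] nz
      by (simp add: F_def left_diff_distrib mult.commute)
  next
    have e: "((\<lambda>x. exp (- s * x)) \<longlongrightarrow> 0) at_top"
      using assms by real_asymp
    have "((\<lambda>x. exp (- s * x) * (s * cos x - sin x)) \<longlongrightarrow> 0) at_top"
    proof (rule Lim_null_comparison)
      show "((\<lambda>x. exp (- s * x) * (s + 1)) \<longlongrightarrow> 0) at_top"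
        using tendsto_mult_right[OF e, of "s + 1"] by (simp add: mult.commute)
      have "norm (exp (- s * x) * (s * cos x - sin x)) \<le> exp (- s * x) * (s + 1)" for x
      proof -
        have "\<bar>s * cos x - sin x\<bar> \<le> \<bar>s * cos x\<bar> + \<bar>sin x\<bar>" by linarith
        also have "\<dots> \<le> s + 1"
          using assms by (intro add_mono) (auto simp: abs_mult mult_left_le)
        finally show ?thesis by (simp add: abs_mult)
      qed
      then show "\<forall>\<^sub>F x in at_top. norm (exp (- s * x) * (s * cos x - sin x)) \<le> exp (- s * x) * (s + 1)"
        by simp
    qed
    from tendsto_add[OF tendsto_divide[OF tendsto_minus[OF e] tendsto_const[of s]]
         tendsto_divide[OF this tendsto_const[of "1 + s\<^sup>2"]]]
    show "(F \<longlongrightarrow> 0) at_top" unfolding F_def using nz by simp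
  qed auto
  also have "0 - F 0 = 1 / (s * (1 + s\<^sup>2))"
    using nz by (simp add: F_def field_simps power2_eq_square)
  finally show ?thesis .
qed

text \<open>Both \<open>x\<^sup>-\<^sup>1\<^sup>-\<^sup>a\<close> and \<open>1 / (1 + s\<^sup>2)\<close> are written as Gamma integrals, so that
  Tonelli reduces the integral to \<open>\<Gamma>(a/2) \<Gamma>(1 - a/2)\<close>.\<close>

lemma nn_integral_one_minus_cos_powr:
  fixes a :: real
  assumes "0 < a" "a < 2"
  shows "(\<integral>\<^sup>+x\<in>{0<..}. ennreal ((1 - cos x) * x powr (- 1 - a)) \<partial>lborel)
    = ennreal (Gamma (a / 2) * Gamma (1 - a / 2) / (2 * Gamma (1 + a)))"
proof -
  define I where "I = (indicator {0<..} :: real \<Rightarrow> ennreal)"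
  have I[measurable]: "I \<in> borel_measurable borel" by (simp add: I_def)
  have Gpos: "Gamma (1 + a) > 0" "Gamma (a / 2) > 0" "Gamma (1 - a / 2) > 0"
    using assms by (auto intro!: Gamma_real_pos)
  \<comment> \<open>The Gamma integral is used with \<open>(b, p, r)\<close> equal to
    \<open>(1 + a, 1, x)\<close> here, \<open>(1, 1, 1 + s\<^sup>2)\<close> in \<open>G2\<close> and
    \<open>(a, 2, r)\<close> in \<open>G3\<close>.\<close>
  have G1: "(\<integral>\<^sup>+s. ennreal (s powr a * exp (- x * s)) * I s \<partial>lborel) = ennreal (Gamma (1 + a) * x powr (- 1 - a))"
    if "x > 0" for x :: real
  proof -
    have "(\<integral>\<^sup>+s. ennreal (s powr a * exp (- x * s)) * I s \<partial>lborel)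
       = (\<integral>\<^sup>+s\<in>{0<..}. ennreal (s powr ((1 + a) - 1) * exp (- x * s powr 1)) \<partial>lborel)"
      unfolding I_def by (intro nn_integral_cong) (auto simp: indicator_def)
    also have "\<dots> = ennreal (Gamma (1 + a) * x powr (- 1 - a))"
      using that assms
      by (subst nn_integral_Gamma_power) (auto simp: powr_diff powr_minus powr_add field_simps)
    finally show ?thesis .
  qed
  have G2: "(\<integral>\<^sup>+r. ennreal (exp (- (1 + s\<^sup>2) * r)) * I r \<partial>lborel) = ennreal (1 / (1 + s\<^sup>2))" for s :: real
  proof -
    have pos: "1 + s\<^sup>2 > 0" by (smt (verit) zero_le_power2)
    have "(\<integral>\<^sup>+r. ennreal (exp (- (1 + s\<^sup>2) * r)) * I r \<partial>lborel)
       = (\<integral>\<^sup>+r\<in>{0<..}. ennreal (r powr (1 - 1) * exp (- (1 + s\<^sup>2) * r powr 1)) \<partial>lborel)"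
      unfolding I_def by (intro nn_integral_cong) (auto simp: indicator_def)
    also have "\<dots> = ennreal (1 / (1 + s\<^sup>2))"
      using pos by (subst nn_integral_Gamma_power) auto
    finally show ?thesis .
  qed
  have G3: "(\<integral>\<^sup>+s. ennreal (s powr (a - 1) * exp (- r * s\<^sup>2)) * I s \<partial>lborel)
      = ennreal (Gamma (a / 2) / 2 * r powr (- a / 2))" if "r > 0" for r :: real
  proof -
    have "(\<integral>\<^sup>+s. ennreal (s powr (a - 1) * exp (- r * s\<^sup>2)) * I s \<partial>lborel)
       = (\<integral>\<^sup>+s\<in>{0<..}. ennreal (s powr (a - 1) * exp (- r * s powr 2)) \<partial>lborel)"
      unfolding I_def by (intro nn_integral_cong) (auto simp: indicator_def)
    also have "\<dots> = ennreal (Gamma (a / 2) / 2 * r powr (- a / 2))"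
      using that assms by (subst nn_integral_Gamma_power) (auto simp: powr_minus field_simps)
    finally show ?thesis .
  qed
  \<comment> \<open>The factor \<open>Gamma (1 + a)\<close> lets \<open>G1\<close> replace the power
    of \<open>x\<close> without a division; being positive and finite, it is cancelled at the
    end.\<close>
  have "ennreal (Gamma (1 + a)) * (\<integral>\<^sup>+x. ennreal ((1 - cos x) * x powr (- 1 - a)) * I x \<partial>lborel)
     = (\<integral>\<^sup>+x. (ennreal (1 - cos x) * I x) * ennreal (Gamma (1 + a) * x powr (- 1 - a)) \<partial>lborel)"
    using Gpos by (subst nn_integral_cmult[symmetric]) (auto simp: ennreal_mult' mult_ac intro!: nn_integral_cong)
  also have "\<dots> = (\<integral>\<^sup>+x. (ennreal (1 - cos x) * I x) * (\<integral>\<^sup>+s. ennreal (s powr a * exp (- x * s)) * I s \<partial>lborel) \<partial>lborel)"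
    by (intro nn_integral_cong) (use G1 in \<open>auto simp: I_def indicator_def\<close>)
  also have "\<dots> = (\<integral>\<^sup>+x. (\<integral>\<^sup>+s. (ennreal (1 - cos x) * I x) * (ennreal (s powr a * exp (- x * s)) * I s) \<partial>lborel) \<partial>lborel)"
    by (intro nn_integral_cong nn_integral_cmult[symmetric]) measurable
  also have "\<dots> = (\<integral>\<^sup>+s. (\<integral>\<^sup>+x. (ennreal (1 - cos x) * I x) * (ennreal (s powr a * exp (- x * s)) * I s) \<partial>lborel) \<partial>lborel)"
    by (rule lborel_pair.Fubini'[symmetric]) measurable
  also have "\<dots> = (\<integral>\<^sup>+s. (ennreal (s powr a) * I s) * (\<integral>\<^sup>+x. ennreal ((1 - cos x) * exp (- s * x)) * I x \<partial>lborel) \<partial>lborel)"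
    by (intro nn_integral_cong, subst nn_integral_cmult[symmetric])
       (auto simp: ennreal_mult mult_ac intro!: nn_integral_cong)
  \<comment> \<open>The integral over \<open>x\<close> is the Laplace transform computed above. Its
    factor \<open>1 / s\<close> lowers the power of \<open>s\<close>, and \<open>G2\<close> opens up
    the other one.\<close>
  also have "\<dots> = (\<integral>\<^sup>+s. (ennreal (s powr (a - 1)) * I s) * (\<integral>\<^sup>+r. ennreal (exp (- (1 + s\<^sup>2) * r)) * I r \<partial>lborel) \<partial>lborel)"
  proof (intro nn_integral_cong)
    fix s :: real
    show "(ennreal (s powr a) * I s) * (\<integral>\<^sup>+x. ennreal ((1 - cos x) * exp (- s * x)) * I x \<partial>lborel)
      = (ennreal (s powr (a - 1)) * I s) * (\<integral>\<^sup>+r. ennreal (exp (- (1 + s\<^sup>2) * r)) * I r \<partial>lborel)"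
    proof (cases "s > 0")
      case True
      then have "s powr a * (1 / (s * (1 + s\<^sup>2))) = s powr (a - 1) * (1 / (1 + s\<^sup>2))"
        by (simp add: powr_diff)
      then show ?thesis
        unfolding G2 using Laplace_one_minus_cos[OF True] True
        by (simp add: I_def ennreal_mult'[symmetric])
    qed (simp add: I_def)
  qed
  also have "\<dots> = (\<integral>\<^sup>+s. (\<integral>\<^sup>+r. (ennreal (s powr (a - 1)) * I s) * (ennreal (exp (- (1 + s\<^sup>2) * r)) * I r) \<partial>lborel) \<partial>lborel)"
    by (intro nn_integral_cong nn_integral_cmult[symmetric]) measurable
  also have "\<dots> = (\<integral>\<^sup>+r. (\<integral>\<^sup>+s. (ennreal (s powr (a - 1)) * I s) * (ennreal (exp (- (1 + s\<^sup>2) * r)) * I r) \<partial>lborel) \<partial>lborel)"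
    by (rule lborel_pair.Fubini'[symmetric]) measurable
  also have "\<dots> = (\<integral>\<^sup>+r. (ennreal (exp (- r)) * I r) * (\<integral>\<^sup>+s. ennreal (s powr (a - 1) * exp (- r * s\<^sup>2)) * I s \<partial>lborel) \<partial>lborel)"
    by (intro nn_integral_cong, subst nn_integral_cmult[symmetric])
       (auto simp: ennreal_mult' mult_ac ring_distribs exp_add[symmetric] exp_diff exp_minus field_simps
          simp flip: ennreal_mult' intro!: nn_integral_cong)
  \<comment> \<open>After \<open>G3\<close> the remaining integral over \<open>r\<close> is the one
    for \<open>Gamma (1 - a / 2)\<close>, convergent at 0 because \<open>a < 2\<close>.\<close>
  also have "\<dots> = (\<integral>\<^sup>+r. ennreal (Gamma (a / 2) / 2) * (ennreal (r powr ((1 - a / 2) - 1) * exp (- 1 * r powr 1)) * I r) \<partial>lborel)"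
  proof (intro nn_integral_cong)
    fix r :: real
    show "(ennreal (exp (- r)) * I r) * (\<integral>\<^sup>+s. ennreal (s powr (a - 1) * exp (- r * s\<^sup>2)) * I s \<partial>lborel)
      = ennreal (Gamma (a / 2) / 2) * (ennreal (r powr ((1 - a / 2) - 1) * exp (- 1 * r powr 1)) * I r)"
    proof (cases "r > 0")
      case True
      then show ?thesis
        using Gpos unfolding G3[OF True] by (simp add: I_def ennreal_mult'[symmetric] mult_ac)
    qed (simp add: I_def)
  qed
  also have "\<dots> = ennreal (Gamma (a / 2) / 2) * ennreal (Gamma (1 - a / 2))"
    unfolding I_def using assms
    by (subst nn_integral_cmult, measurable) (subst nn_integral_Gamma_power, auto)
  also have "\<dots> = ennreal (Gamma (1 + a)) * ennreal (Gamma (a / 2) * Gamma (1 - a / 2) / (2 * Gamma (1 + a)))"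
    using Gpos by (simp add: ennreal_mult'[symmetric])
  finally show ?thesis
    using Gpos by (simp add: I_def ennreal_mult_cancel_left)
qed

text \<open>Euler's reflection formula is applied at \<open>a / 2\<close> and at
  \<open>1 + a\<close>, and the double-angle formula cancels the common sine. The cosine is negative
  for these \<open>a\<close>, so the absolute value absorbs the remaining sign.\<close>

lemma Gamma_reflection_cos:
  fixes a :: real
  assumes "1 < a" "a < 2"
  shows "Gamma (a / 2) * Gamma (1 - a / 2) / (2 * Gamma (1 + a)) = Gamma (- a) * \<bar>cos (a * pi / 2)\<bar>"
proof -
  have refl: "Gamma z * Gamma (1 - z) = pi / sin (pi * z)" for z :: real
  proof -
    have "complex_of_real (Gamma z * Gamma (1 - z)) = complex_of_real (pi / sin (pi * z))"
      using Gamma_reflection_complex[of "of_real z"]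
      unfolding Gamma_complex_of_real of_real_mult of_real_divide sin_of_real
      by (metis Gamma_complex_of_real of_real_1 of_real_diff of_real_mult sin_of_real)
    then show ?thesis by (simp only: of_real_eq_iff)
  qed
  have "a / 2 * pi < pi" using assms by simp
  then have s: "sin (a * pi / 2) > 0" using assms by (intro sin_gt_zero) auto
  have c: "cos (a * pi / 2) < 0"
  proof -
    have "a * pi / 2 = (a - 1) * pi / 2 + pi / 2" by (simp add: field_simps)
    then have "cos (a * pi / 2) = - sin ((a - 1) * pi / 2)" by (simp only: cos_add) simp
    moreover have "sin ((a - 1) * pi / 2) > 0"
      using assms mult_strict_right_mono[of "a - 1" 1 pi] by (intro sin_gt_zero) auto
    ultimately show ?thesis by simp
  qed
  have "pi * (1 + a) = pi + 2 * (a * pi / 2)" by (simp add: field_simps)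
  then have sin: "sin (pi * (1 + a)) = - (2 * sin (a * pi / 2) * cos (a * pi / 2))"
    by (simp only: sin_add sin_double) simp
  have G: "Gamma (1 + a) > 0" using assms by (intro Gamma_real_pos) auto
  have "Gamma (1 + a) * Gamma (- a) = pi / sin (pi * (1 + a))"
    using refl[of "1 + a"] by simp
  then have 1: "Gamma (- a) = pi / (- (2 * sin (a * pi / 2) * cos (a * pi / 2))) / Gamma (1 + a)"
    unfolding sin using G by (simp only: nonzero_eq_divide_eq[of "Gamma (1 + a)"] mult.commute)
  have 2: "Gamma (a / 2) * Gamma (1 - a / 2) = pi / sin (a * pi / 2)"
    using refl[of "a / 2"] by (simp add: mult.commute)
  show ?thesis
    unfolding 1 2 using s c G by simp
qed

subsection \<open>Tails and weak convergence\<close>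

text \<open>Averaging \<open>1 - char \<mu> (e * v)\<close> over a standard normal \<open>v\<close>
  gives the mean of \<open>1 - exp (- (e * x)\<^sup>2 / 2)\<close> under \<mu>, which exceeds a
  third of the tail probability. The constant 6 is 3 times the Gaussian mean 2 of
  \<open>1 + v\<^sup>2\<close>.\<close>

lemma real_distribution_tail_bound:
  fixes \<mu> :: "real measure" and Y A e :: real
  assumes "real_distribution \<mu>"
    and bnd: "\<And>u. norm (1 - char \<mu> u) \<le> a * \<bar>u\<bar> + b * \<bar>u\<bar> powr Y"
    and "0 \<le> a" "0 \<le> b" "1 \<le> Y" "Y \<le> 2" "e > 0"
  shows "measure \<mu> {x. 1 \<le> e * \<bar>x\<bar>} \<le> 6 * (a * e + b * e powr Y)"
proof -
  interpret \<mu>: real_distribution \<mu> by fact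
  let ?N = "std_normal_distribution"
  interpret N: real_distribution ?N by (rule real_dist_normal_dist)
  interpret pair_sigma_finite ?N \<mu> ..
  interpret NM: pair_prob_space ?N \<mu> ..
  have "integrable (?N \<Otimes>\<^sub>M \<mu>) (\<lambda>(v, x). iexp (e * v * x))"
    by (rule NM.integrable_const_bound[where B=1]) (auto simp: norm_exp_i_times split_beta)
  note F = Fubini_integral[OF this]
  \<comment> \<open>The Gaussian factor is the characteristic function of the standard normal law;
    exchanging the integrals moves the average onto \<open>char \<mu>\<close>.\<close>
  have "(CLINT x|\<mu>. complex_of_real (exp (- (e * x)\<^sup>2 / 2))) = (CLINT x|\<mu>. char ?N (e * x))"
    by (simp add: char_std_normal_distribution)
  also have "\<dots> = (CLINT v|?N. char \<mu> (e * v))"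
    unfolding char_def using F by (simp add: mult_ac)
  finally have eq: "complex_of_real (LINT x|\<mu>. exp (- (e * x)\<^sup>2 / 2)) = (CLINT v|?N. char \<mu> (e * v))"
    by simp
  have int1: "integrable \<mu> (\<lambda>x. exp (- (e * x)\<^sup>2 / 2))"
    by (rule \<mu>.integrable_const_bound[where B=1]) auto
  have int2: "integrable ?N (\<lambda>v. char \<mu> (e * v))"
    by (rule N.integrable_const_bound[where B=1]) (auto simp: \<mu>.cmod_char_le_1 intro!: measurable_compose[OF _ \<mu>.char_measurable])
  have M1: "integrable ?N (\<lambda>v. v\<^sup>2)" "(LINT v|?N. v\<^sup>2) = 1"
    using std_normal_distribution_even_moments[of 1] by auto
  have "complex_of_real (LINT x|\<mu>. 1 - exp (- (e * x)\<^sup>2 / 2)) = (CLINT v|?N. 1 - char \<mu> (e * v))"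
    using int1 int2 eq \<mu>.prob_space N.prob_space by simp
  then have "\<bar>LINT x|\<mu>. 1 - exp (- (e * x)\<^sup>2 / 2)\<bar> = norm (CLINT v|?N. 1 - char \<mu> (e * v))"
    by (metis norm_of_real)
  \<comment> \<open>For \<open>1 \<le> Y \<le> 2\<close> both \<open>\<bar>v\<bar>\<close> and
    \<open>\<bar>v\<bar> powr Y\<close> are at most \<open>1 + v\<^sup>2\<close>, so the second
    Gaussian moment suffices.\<close>
  also have "\<dots> \<le> (LINT v|?N. (a * e + b * e powr Y) * (1 + v\<^sup>2))"
  proof (rule Bochner_Integration.integral_norm_bound_integral)
    fix v :: real
    have v: "\<bar>v\<bar> \<le> 1 + v\<^sup>2"
      using zero_le_power2[of "\<bar>v\<bar> - 1"] by (simp add: power2_diff power2_abs)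
    have w: "\<bar>v\<bar> powr Y \<le> 1 + v\<^sup>2"
    proof (cases "\<bar>v\<bar> \<le> 1")
      case True
      then have "\<bar>v\<bar> powr Y \<le> 1" using assms by (intro powr_le1) auto
      then show ?thesis by (smt (verit) zero_le_power2)
    next
      case False
      then have "\<bar>v\<bar> powr Y \<le> \<bar>v\<bar> powr 2" using assms by (intro powr_mono) auto
      also have "\<dots> = v\<^sup>2" using False by (simp add: powr_numeral)
      finally show ?thesis by simp
    qed
    have "norm (1 - char \<mu> (e * v)) \<le> a * \<bar>e * v\<bar> + b * \<bar>e * v\<bar> powr Y" by (rule bnd)
    also have "\<dots> = a * e * \<bar>v\<bar> + b * e powr Y * \<bar>v\<bar> powr Y"
      using assms by (simp add: abs_mult powr_mult)
    also have "\<dots> \<le> a * e * (1 + v\<^sup>2) + b * e powr Y * (1 + v\<^sup>2)"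
      using assms v w by (intro add_mono mult_left_mono) auto
    finally show "norm (1 - char \<mu> (e * v)) \<le> (a * e + b * e powr Y) * (1 + v\<^sup>2)"
      by (simp add: algebra_simps)
  qed (use int2 M1 in auto)
  also have "\<dots> = 2 * (a * e + b * e powr Y)"
    using M1 by (simp add: N.prob_space[simplified])
  finally have le: "(LINT x|\<mu>. 1 - exp (- (e * x)\<^sup>2 / 2)) \<le> 2 * (a * e + b * e powr Y)"
    by linarith
  \<comment> \<open>This makes the integrand at least 1/3 wherever
    \<open>1 \<le> e * \<bar>x\<bar>\<close>.\<close>
  have ex: "exp (- 1 / 2 :: real) \<le> 2 / 3"
  proof -
    have "3 / 2 \<le> exp (1 / 2 :: real)" using exp_ge_add_one_self[of "1 / 2"] by simp
    then show ?thesis by (simp add: exp_minus field_simps)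
  qed
  have int3: "integrable \<mu> (\<lambda>x. indicator {x. 1 \<le> e * \<bar>x\<bar>} x / 3 :: real)"
    by (rule \<mu>.integrable_const_bound[where B=1]) (auto split: split_indicator)
  have "measure \<mu> {x. 1 \<le> e * \<bar>x\<bar>} / 3 = (LINT x|\<mu>. indicator {x. 1 \<le> e * \<bar>x\<bar>} x / 3)"
    by simp
  also have "\<dots> \<le> (LINT x|\<mu>. 1 - exp (- (e * x)\<^sup>2 / 2))"
  proof (rule Bochner_Integration.integral_mono)
    fix x
    show "indicator {x. 1 \<le> e * \<bar>x\<bar>} x / 3 \<le> 1 - exp (- (e * x)\<^sup>2 / 2)"
    proof (cases "1 \<le> e * \<bar>x\<bar>")
      case True
      then have "1 \<le> (e * \<bar>x\<bar>)\<^sup>2" by (rule one_le_power)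
      then have "exp (- (e * x)\<^sup>2 / 2) \<le> exp (- 1 / 2)" by (simp add: power_mult_distrib)
      from order_trans[OF this ex] show ?thesis using True by simp
    qed simp
  qed (use int1 int3 in auto)
  finally show ?thesis using le by simp
qed

section \<open>Expectations through tail probabilities and the limit of the rescaled put\<close>

text \<open>The value \<open>f \<omega>\<close> is the length of the interval
  \<open>{0<..<f \<omega>}\<close>; Tonelli then integrates over \<omega> first.\<close>

lemma (in prob_space) nn_integral_layer_cake:
  assumes f[measurable]: "f \<in> borel_measurable M" and nonneg: "\<And>\<omega>. 0 \<le> f \<omega>"
  shows "(\<integral>\<^sup>+\<omega>. ennreal (f \<omega>) \<partial>M)
    = (\<integral>\<^sup>+y. ennreal (prob {\<omega> \<in> space M. y < f \<omega>} * indicator {0<..} y) \<partial>lborel)"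
proof -
  interpret pair_sigma_finite M lborel ..
  define I where "I = (\<lambda>\<omega> y. if 0 < y \<and> y < f \<omega> then 1 else (0 :: ennreal))"
  have [measurable]: "(\<lambda>(\<omega>, y). I \<omega> y) \<in> borel_measurable (M \<Otimes>\<^sub>M lborel)"
    unfolding I_def by measurable
  have "(\<integral>\<^sup>+\<omega>. ennreal (f \<omega>) \<partial>M) = (\<integral>\<^sup>+\<omega>. (\<integral>\<^sup>+y. I \<omega> y \<partial>lborel) \<partial>M)"
  proof (intro nn_integral_cong)
    fix \<omega>
    have "I \<omega> = indicator {0<..<f \<omega>}" by (auto simp: I_def indicator_def)
    then show "ennreal (f \<omega>) = (\<integral>\<^sup>+y. I \<omega> y \<partial>lborel)" using nonneg[of \<omega>] by simp
  qed
  also have "\<dots> = (\<integral>\<^sup>+y. (\<integral>\<^sup>+\<omega>. I \<omega> y \<partial>M) \<partial>lborel)"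
    by (rule Fubini'[symmetric]) measurable
  also have "\<dots> = (\<integral>\<^sup>+y. ennreal (prob {\<omega> \<in> space M. y < f \<omega>} * indicator {0<..} y) \<partial>lborel)"
  proof (intro nn_integral_cong)
    fix y :: real
    show "(\<integral>\<^sup>+\<omega>. I \<omega> y \<partial>M) = ennreal (prob {\<omega> \<in> space M. y < f \<omega>} * indicator {0<..} y)"
    proof (cases "0 < y")
      case True
      have "(\<integral>\<^sup>+\<omega>. I \<omega> y \<partial>M) = (\<integral>\<^sup>+\<omega>. indicator {\<omega> \<in> space M. y < f \<omega>} \<omega> \<partial>M)"
        by (intro nn_integral_cong) (use True in \<open>auto simp: I_def indicator_def\<close>)
      also have "\<dots> = emeasure M {\<omega> \<in> space M. y < f \<omega>}" by simp
      finally show ?thesis using True by (simp add: emeasure_eq_measure)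
    qed (simp add: I_def)
  qed
  finally show ?thesis .
qed

lemma integrable_powr_tail:
  fixes Y :: real
  assumes "1 < Y"
  shows "integrable lborel (\<lambda>y. indicator {1..} y * y powr (- Y))"
proof -
  have "(\<lambda>y. y powr (- Y)) absolutely_integrable_on {1..}"
    using has_integral_powr_to_inf[of "- Y" 1] assms
    by (intro nonnegative_absolutely_integrable_1) (auto simp: integrable_on_def)
  then have "integrable lebesgue (\<lambda>y. indicator {1..} y *\<^sub>R y powr (- Y))"
    by (simp add: set_integrable_def)
  then show ?thesis
    by (subst (asm) integrable_completion) auto
qed

text \<open>Caratheodory's form of the derivative of \<open>exp\<close> at 0 gives a factorization
  valid at 0 as well, so \<open>y n\<close> is allowed to vanish.\<close>

lemma tendsto_exp_difference_quotient:
  assumes h: "h \<longlonglongrightarrow> (0::real)" "\<And>n. h n \<noteq> 0" and y: "y \<longlonglongrightarrow> l"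
  shows "(\<lambda>n. (exp (h n * y n) - 1) / h n) \<longlonglongrightarrow> (l :: real)"
proof -
  obtain g :: "real \<Rightarrow> real" where g: "\<And>z. exp z - exp 0 = g z * (z - 0)" "isCont g 0" "g 0 = 1"
    using DERIV_exp[of "0::real"] unfolding CARAT_DERIV by auto
  have "(\<lambda>n. h n * y n) \<longlonglongrightarrow> 0" using tendsto_mult[OF h(1) y] by simp
  then have "(\<lambda>n. g (h n * y n)) \<longlonglongrightarrow> 1" using isCont_tendsto_compose[OF g(2)] g(3) by metis
  then have "(\<lambda>n. g (h n * y n) * y n) \<longlonglongrightarrow> 1 * l" using y by (rule tendsto_mult)
  moreover have "(exp (h n * y n) - 1) / h n = g (h n * y n) * y n" for n
    using g(1)[of "h n * y n"] h(2)[of n] by simp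
  ultimately show ?thesis by simp
qed

text \<open>Skorohod's theorem turns weak convergence into pointwise convergence of random
  variables, and the rescaled payoff then converges to the negative part. The hypotheses dominate
  tail probabilities rather than payoffs, so dominated convergence is applied to the tails as
  functions of the level \<open>y\<close>.\<close>

lemma weak_conv_integral_rescaled_put:
  fixes \<mu> :: "nat \<Rightarrow> real measure" and \<mu>' :: "real measure" and h :: "nat \<Rightarrow> real"
  assumes \<mu>: "\<And>n. real_distribution (\<mu> n)" and \<mu>': "real_distribution \<mu>'"
    and weak: "weak_conv_m \<mu> \<mu>'"
    and h: "\<And>n. h n > 0" "h \<longlonglongrightarrow> 0"
    and tail: "\<And>n y. \<lbrakk>0 < y; y * h n < 1\<rbrakk> \<Longrightarrow> measure (\<mu> n) {x. y \<le> \<bar>x\<bar>} \<le> A * y powr (- Y)"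
    and "0 \<le> A" "1 < Y"
  shows "integrable \<mu>' (\<lambda>x. max (- x) 0)"
    and "(\<lambda>n. LINT x|\<mu> n. max (1 - exp (h n * x)) 0 / h n) \<longlonglongrightarrow> (LINT x|\<mu>'. max (- x) 0)"
proof -
  obtain \<Omega> :: "real measure" and W :: "nat \<Rightarrow> real \<Rightarrow> real" and V :: "real \<Rightarrow> real"
    where \<Omega>: "prob_space \<Omega>"
      and W[measurable]: "\<And>n. W n \<in> borel_measurable \<Omega>" and dW: "\<And>n. distr \<Omega> borel (W n) = \<mu> n"
      and V: "V \<in> measurable \<Omega> lborel" and dV: "distr \<Omega> borel V = \<mu>'"
      and lim: "\<And>x. x \<in> space \<Omega> \<Longrightarrow> (\<lambda>n. W n x) \<longlonglongrightarrow> V x"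
    using Skorohod[OF \<mu> \<mu>' weak] by metis
  have [measurable]: "V \<in> borel_measurable \<Omega>" using V by simp
  interpret prob_space \<Omega> by fact
  define f where "f = (\<lambda>n \<omega>. max (1 - exp (h n * W n \<omega>)) 0 / h n)"
  define g where "g = (\<lambda>\<omega>. max (- V \<omega>) 0)"
  have [measurable]: "f n \<in> borel_measurable \<Omega>" "g \<in> borel_measurable \<Omega>" for n
    unfolding f_def g_def by measurable
  have f0: "0 \<le> f n \<omega>" and g0: "0 \<le> g \<omega>" for n \<omega>
    using h(1)[of n] by (auto simp: f_def g_def)
  have flim: "(\<lambda>n. f n \<omega>) \<longlonglongrightarrow> g \<omega>" if "\<omega> \<in> space \<Omega>" for \<omega>
  proof -
    have "(\<lambda>n. (exp (h n * W n \<omega>) - 1) / h n) \<longlonglongrightarrow> V \<omega>"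
      using h less_imp_neq[OF h(1)] lim[OF that] by (intro tendsto_exp_difference_quotient) (metis less_irrefl)+
    then have "(\<lambda>n. max (- ((exp (h n * W n \<omega>) - 1) / h n)) 0) \<longlonglongrightarrow> g \<omega>"
      unfolding g_def by (intro tendsto_intros)
    moreover have "max (- ((exp (h n * W n \<omega>) - 1) / h n)) 0 = f n \<omega>" for n
      using h(1)[of n] by (auto simp: f_def max_def field_simps)
    ultimately show ?thesis by simp
  qed
  define Gn where "Gn = (\<lambda>n y. prob {\<omega> \<in> space \<Omega>. y < f n \<omega>} * indicator {0<..} y :: real)"
  define G where "G = (\<lambda>y. prob {\<omega> \<in> space \<Omega>. y < g \<omega>} * indicator {0<..} y :: real)"
  \<comment> \<open>Tails are at most 1 below level 1; from there on the tail hypothesis takes over,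
    with an integrable bound because \<open>1 < Y\<close>.\<close>
  define D where "D = (\<lambda>y::real. indicator {0<..<1} y + A * (indicator {1..} y * y powr (- Y)) :: real)"
  have [measurable]: "Gn n \<in> borel_measurable lborel" "G \<in> borel_measurable lborel" for n
    unfolding Gn_def G_def by measurable
  have D: "integrable lborel D"
    unfolding D_def using integrable_powr_tail[OF \<open>1 < Y\<close>] by (intro Bochner_Integration.integrable_add integrable_mult_right) auto
  have bound: "norm (Gn n y) \<le> D y" for n y
  proof (cases "y < 1")
    case True
    then show ?thesis by (auto simp: Gn_def D_def indicator_def)
  next
    case False
    show ?thesis
    proof (cases "y * h n < 1")
      case True
      have "{\<omega> \<in> space \<Omega>. y < f n \<omega>} \<subseteq> W n -` {x. y \<le> \<bar>x\<bar>} \<inter> space \<Omega>"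
      proof (intro subsetI)
        fix \<omega> assume \<omega>: "\<omega> \<in> {\<omega> \<in> space \<Omega>. y < f n \<omega>}"
        then have "y < f n \<omega>" by simp
        then have *: "y < (1 - exp (h n * W n \<omega>)) / h n" using False h(1)[of n]
          by (auto simp: f_def max_def split: if_splits)
        \<comment> \<open>Convexity of \<open>exp\<close> bounds the payoff by
          \<open>- W n \<omega>\<close>, so a payoff above \<open>y\<close> forces
          \<open>\<bar>W n \<omega>\<bar> \<ge> y\<close>.\<close>
        have "1 - exp (h n * W n \<omega>) \<le> - W n \<omega> * h n"
          using exp_ge_add_one_self[of "h n * W n \<omega>"] by (simp only: mult.commute mult_minus_right)
        then have "(1 - exp (h n * W n \<omega>)) / h n \<le> - W n \<omega>"
          using h(1)[of n] by (simp only: pos_divide_le_eq)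
        with * have "y \<le> \<bar>W n \<omega>\<bar>" by linarith
        with \<omega> show "\<omega> \<in> W n -` {x. y \<le> \<bar>x\<bar>} \<inter> space \<Omega>" by simp
      qed
      then have "prob {\<omega> \<in> space \<Omega>. y < f n \<omega>} \<le> prob (W n -` {x. y \<le> \<bar>x\<bar>} \<inter> space \<Omega>)"
        by (intro finite_measure_mono) measurable
      also have "\<dots> = measure (\<mu> n) {x. y \<le> \<bar>x\<bar>}"
        unfolding dW[symmetric] by (subst measure_distr) auto
      also have "\<dots> \<le> A * y powr (- Y)" using tail[of y n] True False by auto
      finally show ?thesis using False by (simp add: Gn_def D_def)
    next
      case F2: False
      \<comment> \<open>The payoff never exceeds \<open>1 / h n\<close>, hence its tail is empty
        from that level on. This is why the tail hypothesis asks only for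
        \<open>y * h n < 1\<close>.\<close>
      have "\<not> y < f n \<omega>" for \<omega>
      proof -
        have "f n \<omega> \<le> 1 / h n" unfolding f_def using h(1)[of n] by (intro divide_right_mono) auto
        also have "\<dots> \<le> y" using F2 h(1)[of n] by (simp add: pos_divide_le_eq)
        finally show ?thesis by simp
      qed
      then have "Gn n y = 0" by (simp add: Gn_def)
      then show ?thesis using \<open>0 \<le> A\<close> by (simp add: D_def)
    qed
  qed
  interpret dg: prob_space "distr \<Omega> borel g" by (rule prob_space_distr) measurable
  \<comment> \<open>A law on the line has countably many atoms. At every other level the event
    \<open>g \<omega> = y\<close> is null, and off it the indicators converge.\<close>
  have "AE y in lborel. y \<notin> {y. measure (distr \<Omega> borel g) {y} \<noteq> 0}"
    by (intro AE_not_in countable_imp_null_set_lborel dg.countable_support)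
  then have conv: "AE y in lborel. (\<lambda>n. Gn n y) \<longlonglongrightarrow> G y"
  proof eventually_elim
    case (elim y)
    have "prob (g -` {y} \<inter> space \<Omega>) = 0" using elim by (simp add: measure_distr)
    then have "AE \<omega> in \<Omega>. \<omega> \<notin> g -` {y} \<inter> space \<Omega>"
      by (intro AE_not_in) (auto simp: null_sets_def emeasure_eq_measure)
    then have ne: "AE \<omega> in \<Omega>. g \<omega> \<noteq> y" by (auto)
    have "(\<lambda>n. LINT \<omega>|\<Omega>. indicator {\<omega> \<in> space \<Omega>. y < f n \<omega>} \<omega> :: real) \<longlonglongrightarrow>
        (LINT \<omega>|\<Omega>. indicator {\<omega> \<in> space \<Omega>. y < g \<omega>} \<omega>)"
    proof (rule integral_dominated_convergence[where w = "\<lambda>_. 1"])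
      show "AE \<omega> in \<Omega>. (\<lambda>n. indicator {\<omega> \<in> space \<Omega>. y < f n \<omega>} \<omega> :: real) \<longlonglongrightarrow> indicator {\<omega> \<in> space \<Omega>. y < g \<omega>} \<omega>"
        using ne AE_space
      proof eventually_elim
        case (elim \<omega>)
        show ?case
        proof (cases "y < g \<omega>")
          case True
          then have "eventually (\<lambda>n. y < f n \<omega>) sequentially" using flim[of \<omega>] elim by (simp add: order_tendsto_iff)
          then have "eventually (\<lambda>n. indicator {\<omega> \<in> space \<Omega>. y < f n \<omega>} \<omega> = (1::real)) sequentially"
            by eventually_elim (use elim in auto)
          then show ?thesis using True elim by (simp add: tendsto_eventually)
        next
          case False
          then have "g \<omega> < y" using elim by simp
          then have "eventually (\<lambda>n. f n \<omega> < y) sequentially" using flim[of \<omega>] elim by (simp add: order_tendsto_iff)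
          then have "eventually (\<lambda>n. indicator {\<omega> \<in> space \<Omega>. y < f n \<omega>} \<omega> = (0::real)) sequentially"
            by eventually_elim auto
          then show ?thesis using False elim by (simp add: tendsto_eventually)
        qed
      qed
    qed auto
    then show ?case unfolding Gn_def G_def by (intro tendsto_mult tendsto_const) simp
  qed
  \<comment> \<open>Domination also yields integrability of the limiting tail, and with it the
    finite mean of the negative part under \<open>\<mu>'\<close>.\<close>
  have intG: "integrable lborel G"
    by (rule integrable_dominated_convergence[where s = Gn, OF _ _ D]) (use conv bound in auto)
  have limG: "(\<lambda>n. integral\<^sup>L lborel (Gn n)) \<longlonglongrightarrow> integral\<^sup>L lborel G"
    by (rule integral_dominated_convergence[OF _ _ D]) (use conv bound in auto)
  have Gnn: "0 \<le> Gn n y" "0 \<le> G y" for n y by (auto simp: Gn_def G_def)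
  have nf: "(\<integral>\<^sup>+\<omega>. ennreal (f n \<omega>) \<partial>\<Omega>) = (\<integral>\<^sup>+y. ennreal (Gn n y) \<partial>lborel)" for n
    unfolding Gn_def by (rule nn_integral_layer_cake) (auto simp: f0)
  have ng: "(\<integral>\<^sup>+\<omega>. ennreal (g \<omega>) \<partial>\<Omega>) = (\<integral>\<^sup>+y. ennreal (G y) \<partial>lborel)"
    unfolding G_def by (rule nn_integral_layer_cake) (auto simp: g0)
  have "integrable \<Omega> g"
  proof (rule integrableI_nonneg)
    show "(\<integral>\<^sup>+\<omega>. ennreal (g \<omega>) \<partial>\<Omega>) < \<infinity>"
      using intG Gnn unfolding ng by (simp add: nn_integral_eq_integral)
  qed (auto simp: g0)
  then show "integrable \<mu>' (\<lambda>x. max (- x) 0)"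
    unfolding dV[symmetric] g_def by (subst integrable_distr_eq) auto
  have "integral\<^sup>L \<Omega> (f n) = integral\<^sup>L lborel (Gn n)" for n
    using nf[of n] by (subst (1 2) integral_eq_nn_integral) (auto simp: f0 Gnn)
  moreover have "integral\<^sup>L \<Omega> g = integral\<^sup>L lborel G"
    using ng by (subst (1 2) integral_eq_nn_integral) (auto simp: g0 Gnn)
  moreover have "(LINT x|\<mu> n. max (1 - exp (h n * x)) 0 / h n) = integral\<^sup>L \<Omega> (f n)" for n
    unfolding dW[symmetric] f_def by (subst integral_distr) auto
  moreover have "(LINT x|\<mu>'. max (- x) 0) = integral\<^sup>L \<Omega> g"
    unfolding dV[symmetric] g_def by (subst integral_distr) auto
  ultimately show "(\<lambda>n. LINT x|\<mu> n. max (1 - exp (h n * x)) 0 / h n) \<longlonglongrightarrow> (LINT x|\<mu>'. max (- x) 0)"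
    using limG by simp
qed

subsection \<open>Tempered stable exponents\<close>

text \<open>The compensator is not truncated, so that in the jump integral \<open>u\<close> and
  \<open>x\<close> enter only through \<open>u * x\<close>, as scaling requires.\<close>

definition compensated_iexp :: "real \<Rightarrow> complex" where
  "compensated_iexp y = iexp y - 1 - \<i> * complex_of_real y"

lemma compensated_iexp_measurable[measurable]: "compensated_iexp \<in> borel_measurable borel"
  unfolding compensated_iexp_def by measurable

text \<open>The two Taylor remainder estimates for \<open>iexp\<close>, the quadratic one effective
  near 0 and the linear one far away.\<close>

lemma norm_compensated_iexp_le: "norm (compensated_iexp y) \<le> 2 * min \<bar>y\<bar> (y\<^sup>2)"
proof -
  have "norm (compensated_iexp y) \<le> y\<^sup>2 / 2" "norm (compensated_iexp y) \<le> 2 * \<bar>y\<bar>"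
    using iexp_approx1[of y 1] iexp_approx2[of y 1]
    by (simp_all add: compensated_iexp_def algebra_simps power2_eq_square fact_numeral)
  moreover have "y\<^sup>2 / 2 \<le> 2 * y\<^sup>2" by simp
  ultimately have "norm (compensated_iexp y) \<le> 2 * \<bar>y\<bar>" "norm (compensated_iexp y) \<le> 2 * y\<^sup>2"
    by linarith+
  then show ?thesis by (simp add: min_def)
qed

text \<open>Up to the factor 2 this dominates the compensated stable integrand at
  \<open>u = 1\<close>.\<close>

definition stable_majorant :: "real \<Rightarrow> real \<Rightarrow> real" where
  "stable_majorant Y x = min \<bar>x\<bar> (x\<^sup>2) * \<bar>x\<bar> powr (- 1 - Y)"

lemma stable_majorant_measurable[measurable]: "stable_majorant Y \<in> borel_measurable borel"
  unfolding stable_majorant_def by measurable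

lemma stable_majorant_nonneg: "0 \<le> stable_majorant Y x"
  by (simp add: stable_majorant_def)

text \<open>On the positive half-line the function behaves like \<open>x powr (1 - Y)\<close> near 0
  and like \<open>x powr (- Y)\<close> at infinity, integrable for \<open>Y < 2\<close> and
  \<open>1 < Y\<close> respectively; evenness covers the other half-line.\<close>

lemma stable_majorant_integrable:
  assumes "1 < Y" "Y < 2"
  shows "integrable lborel (stable_majorant Y)"
proof -
  define P where "P = (\<lambda>x::real. indicator {0..1} x * x powr (1 - Y) + indicator {1..} x * x powr (- Y) :: real)"
  have "(\<lambda>x. x powr (1 - Y)) absolutely_integrable_on {0..1}"
    using integrable_on_powr_from_0[of "1 - Y" 1] assms
    by (intro nonnegative_absolutely_integrable_1) auto
  then have "integrable lebesgue (\<lambda>x. indicator {0..1} x * x powr (1 - Y))"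
    by (simp add: set_integrable_def)
  then have "integrable lborel (\<lambda>x. indicator {0..1} x * x powr (1 - Y))"
    by (subst (asm) integrable_completion) auto
  then have P: "integrable lborel P"
    unfolding P_def using integrable_powr_tail[OF \<open>1 < Y\<close>] by (rule Bochner_Integration.integrable_add)
  have P0: "0 \<le> P x" for x by (simp add: P_def)
  have pos: "stable_majorant Y x \<le> P x" if "x > 0" for x
  proof (cases "x \<le> 1")
    case True
    have "stable_majorant Y x \<le> x\<^sup>2 * x powr (- 1 - Y)"
      using that by (simp add: stable_majorant_def mult_right_mono)
    also have "\<dots> = x powr 2 * x powr (- 1 - Y)"
      using that by (simp add: powr_numeral)
    also have "\<dots> = x powr (1 - Y)"
      by (simp add: powr_add[symmetric])
    finally show ?thesis using True that by (auto simp: P_def indicator_def)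
  next
    case False
    have "stable_majorant Y x \<le> x * x powr (- 1 - Y)"
      using that by (simp add: stable_majorant_def mult_right_mono)
    also have "\<dots> = x powr 1 * x powr (- 1 - Y)"
      using that by simp
    also have "\<dots> = x powr (- Y)"
      by (simp only: powr_add[symmetric]) simp
    finally show ?thesis using False that by (simp add: P_def)
  qed
  have "stable_majorant Y x \<le> P x + P (- x)" for x
  proof -
    have "stable_majorant Y x = stable_majorant Y (- x)" "stable_majorant Y 0 = 0"
      by (auto simp: stable_majorant_def)
    then show ?thesis using pos[of x] pos[of "- x"] P0[of x] P0[of "- x"]
      by (cases x "0 :: real" rule: linorder_cases) auto
  qed
  then have le: "norm (stable_majorant Y x) \<le> norm (P x + P (- x))" for x
    using P0[of x] P0[of "- x"] stable_majorant_nonneg[of Y x] by simp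
  have "integrable lborel (\<lambda>x. P x + P (- x))"
    using P lborel_integrable_real_affine[OF P, of "- 1" 0] by simp
  then show ?thesis
    by (rule Bochner_Integration.integrable_bound) (auto simp only: le intro!: AE_I2, simp)
qed

text \<open>The tempering factor is bounded by 1. Rescaling by \<open>u\<close> then yields
  \<open>\<bar>u\<bar> powr (1 + Y)\<close> from the power kernel and
  \<open>1 / \<bar>u\<bar>\<close> from the Lebesgue measure.\<close>

lemma tempered_stable_integral:
  fixes q :: "real \<Rightarrow> real"
  assumes Y: "1 < Y" "Y < 2"
    and q[measurable]: "q \<in> borel_measurable borel" and q01: "\<And>x. 0 \<le> q x" "\<And>x. q x \<le> 1"
  shows "integrable lborel (\<lambda>x. complex_of_real (q x * \<bar>x\<bar> powr (- 1 - Y)) * compensated_iexp (u * x))" (is "integrable _ ?f")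
    and "norm (CLINT x|lborel. complex_of_real (q x * \<bar>x\<bar> powr (- 1 - Y)) * compensated_iexp (u * x))
      \<le> 2 * (LINT x|lborel. stable_majorant Y x) * \<bar>u\<bar> powr Y"
proof -
  note H = stable_majorant_integrable[OF Y]
  have bnd: "norm (?f x) \<le> 2 * \<bar>u\<bar> powr (1 + Y) * stable_majorant Y (u * x)" for x
  proof (cases "u = 0 \<or> x = 0")
    case False
    have eq: "\<bar>x\<bar> powr (- 1 - Y) = \<bar>u\<bar> powr (1 + Y) * \<bar>u * x\<bar> powr (- 1 - Y)"
      using False by (simp add: abs_mult powr_mult powr_add[symmetric] mult.assoc[symmetric])
    have "norm (?f x) = q x * \<bar>x\<bar> powr (- 1 - Y) * norm (compensated_iexp (u * x))"
      using q01 by (simp add: norm_mult)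
    also have "\<dots> \<le> 1 * \<bar>x\<bar> powr (- 1 - Y) * (2 * min \<bar>u * x\<bar> ((u * x)\<^sup>2))"
      using q01 norm_compensated_iexp_le by (intro mult_mono) auto
    also have "\<dots> = 2 * \<bar>u\<bar> powr (1 + Y) * stable_majorant Y (u * x)"
      unfolding eq stable_majorant_def by simp
    finally show ?thesis .
  qed (auto simp: compensated_iexp_def stable_majorant_def)
  have int: "integrable lborel (\<lambda>x. 2 * \<bar>u\<bar> powr (1 + Y) * stable_majorant Y (u * x))"
    using lborel_integrable_real_affine[OF H, of u 0] by (cases "u = 0") (auto simp: stable_majorant_def)
  show I: "integrable lborel ?f"
  proof (rule Bochner_Integration.integrable_bound[OF int])
    show "AE x in lborel. norm (?f x) \<le> norm (2 * \<bar>u\<bar> powr (1 + Y) * stable_majorant Y (u * x))"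
    proof (intro AE_I2)
      fix x
      show "norm (?f x) \<le> norm (2 * \<bar>u\<bar> powr (1 + Y) * stable_majorant Y (u * x))"
        using order_trans[OF bnd abs_ge_self] by simp
    qed
  qed measurable
  have "norm (integral\<^sup>L lborel ?f) \<le> (LINT x|lborel. 2 * \<bar>u\<bar> powr (1 + Y) * stable_majorant Y (u * x))"
    by (rule Bochner_Integration.integral_norm_bound_integral[OF I int]) (rule bnd)
  also have "\<dots> = 2 * (LINT x|lborel. stable_majorant Y x) * \<bar>u\<bar> powr Y"
  proof (cases "u = 0")
    case False
    have "(LINT x|lborel. stable_majorant Y x) = \<bar>u\<bar> * (LINT x|lborel. stable_majorant Y (u * x))"
      using lborel_integral_real_affine[of u "stable_majorant Y" 0] False by simp
    then show ?thesis using False by (simp add: powr_add)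
  qed (simp add: stable_majorant_def)
  finally show "norm (integral\<^sup>L lborel ?f) \<le> 2 * (LINT x|lborel. stable_majorant Y x) * \<bar>u\<bar> powr Y" .
qed

text \<open>As \<open>Y > 1\<close>, the large jumps are integrable and can be compensated as well, at the price of
  changing the drift.\<close>

lemma levy_exponent_tempered_stable:
  fixes q :: "real \<Rightarrow> real"
  assumes Y: "1 < Y" "Y < 2" and "0 \<le> C"
    and q[measurable]: "q \<in> borel_measurable borel" and q01: "\<And>x. 0 \<le> q x" "\<And>x. q x \<le> 1"
  shows "\<exists>b'. \<forall>u. levy_exponent b 0 (density lborel (\<lambda>x. ennreal (C * (q x * \<bar>x\<bar> powr (- 1 - Y))))) u
    = \<i> * complex_of_real (b' * u)
      + complex_of_real C * (CLINT x|lborel. complex_of_real (q x * \<bar>x\<bar> powr (- 1 - Y)) * compensated_iexp (u * x))"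
proof (intro exI allI)
  fix u
  define K where "K = (\<lambda>x. q x * \<bar>x\<bar> powr (- 1 - Y))"
  have K[measurable]: "K \<in> borel_measurable borel" unfolding K_def by measurable
  have K0: "0 \<le> K x" for x using q01 by (simp add: K_def)
  \<comment> \<open>\<open>C * J\<close> is the density of the first moment of the jumps larger than
    1, by which the two compensators differ.\<close>
  define J where "J = (\<lambda>x. K x * (x * indicator (- {-1..1}) x))"
  have J: "integrable lborel J"
  proof (rule Bochner_Integration.integrable_bound[OF stable_majorant_integrable[OF Y]])
    show "AE x in lborel. norm (J x) \<le> norm (stable_majorant Y x)"
    proof (intro AE_I2)
      fix x :: real
      show "norm (J x) \<le> norm (stable_majorant Y x)"
      proof (cases "\<bar>x\<bar> \<le> 1")
        case True
        then show ?thesis by (simp add: J_def abs_le_iff)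
      next
        case False
        then have "\<bar>x\<bar> * 1 \<le> \<bar>x\<bar> * \<bar>x\<bar>" by (intro mult_left_mono) auto
        then have "min \<bar>x\<bar> (x\<^sup>2) = \<bar>x\<bar>" by (simp add: power2_eq_square)
        moreover have "norm (J x) \<le> (1 * \<bar>x\<bar> powr (- 1 - Y)) * \<bar>x\<bar>"
          unfolding J_def K_def using q01
          by (auto simp: abs_mult indicator_def intro!: mult_right_mono mult_left_le_one_le)
        ultimately show ?thesis by (simp add: stable_majorant_def mult.commute)
      qed
    qed
  qed (simp add: J_def)
  let ?\<theta> = "\<lambda>x. complex_of_real (K x) * compensated_iexp (u * x)"
  have \<theta>: "integrable lborel ?\<theta>"
    unfolding K_def by (rule tempered_stable_integral[OF Y q q01])
  have "integral\<^sup>L (density lborel (\<lambda>x. ennreal (C * K x)))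
      (\<lambda>x. iexp (u * x) - 1 - \<i> * complex_of_real (u * x * indicator {-1..1} x))
    = (CLINT x|lborel. (C * K x) *\<^sub>R (iexp (u * x) - 1 - \<i> * complex_of_real (u * x * indicator {-1..1} x)))"
    using K0 \<open>0 \<le> C\<close> by (subst integral_density) auto
  also have "\<dots> = (CLINT x|lborel. complex_of_real C * ?\<theta> x + \<i> * complex_of_real (C * u) * complex_of_real (J x))"
    by (intro Bochner_Integration.integral_cong refl)
       (auto simp: compensated_iexp_def J_def indicator_def scaleR_conv_of_real algebra_simps)
  also have "\<dots> = complex_of_real C * integral\<^sup>L lborel ?\<theta> + \<i> * complex_of_real (C * u) * complex_of_real (LINT x|lborel. J x)"
    using \<theta> J by (subst Bochner_Integration.integral_add) auto
  \<comment> \<open>The drift is shifted by \<open>C\<close> times the integral of \<open>J\<close>,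
    a quantity independent of \<open>u\<close>.\<close>
  finally show "levy_exponent b 0 (density lborel (\<lambda>x. ennreal (C * (q x * \<bar>x\<bar> powr (- 1 - Y))))) u
    = \<i> * complex_of_real ((b + C * (LINT x|lborel. q x * \<bar>x\<bar> powr (- 1 - Y) * (x * indicator (- {-1..1}) x))) * u)
      + complex_of_real C * (CLINT x|lborel. complex_of_real (q x * \<bar>x\<bar> powr (- 1 - Y)) * compensated_iexp (u * x))"
    by (simp add: levy_exponent_def K_def J_def algebra_simps)
qed

section \<open>The stable exponent as a scaling limit\<close>

text \<open>By evenness the case \<open>u = 1\<close> is twice the half-line integral evaluated with
  Gamma functions; a linear substitution gives the power of \<open>u\<close>.\<close>

lemma one_minus_cos_powr_integral:
  assumes "1 < Y" "Y < 2"
  shows "(LINT x|lborel. \<bar>x\<bar> powr (- 1 - Y) * (1 - cos (u * x))) = 2 * Gamma (- Y) * \<bar>cos (Y * pi / 2)\<bar> * \<bar>u\<bar> powr Y"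
proof -
  define c where "c = Gamma (- Y) * \<bar>cos (Y * pi / 2)\<bar>"
  define f where "f = (\<lambda>x. ennreal ((1 - cos x) * x powr (- 1 - Y)) * indicator {0<..} x)"
  have [measurable]: "f \<in> borel_measurable borel" unfolding f_def by measurable
  have f: "(\<integral>\<^sup>+x. f x \<partial>lborel) = ennreal c"
    unfolding f_def c_def using assms
    by (simp add: nn_integral_one_minus_cos_powr Gamma_reflection_cos)
  \<comment> \<open>The identity is read backwards, as a quotient of Gamma values at positive
    arguments, whose sign is clear.\<close>
  have c: "0 \<le> c"
    unfolding c_def Gamma_reflection_cos[OF assms, symmetric] using assms
    by (intro divide_nonneg_nonneg mult_nonneg_nonneg less_imp_le[OF Gamma_real_pos]) auto
  have "(\<integral>\<^sup>+x. ennreal (\<bar>x\<bar> powr (- 1 - Y) * (1 - cos x)) \<partial>lborel) = (\<integral>\<^sup>+x. f x + f (- x) \<partial>lborel)"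
    by (intro nn_integral_cong) (auto simp: f_def indicator_def mult.commute)
  also have "\<dots> = ennreal c + ennreal c"
    using f nn_integral_real_affine[of f "- 1" 0] by (simp add: nn_integral_add)
  also have "\<dots> = ennreal (2 * c)" using c by (simp flip: ennreal_plus)
  finally have 1: "(LINT x|lborel. \<bar>x\<bar> powr (- 1 - Y) * (1 - cos x)) = 2 * c"
    using c by (subst integral_eq_nn_integral) auto
  show ?thesis
  proof (cases "u = 0")
    case False
    have "2 * c = \<bar>u\<bar> * (LINT x|lborel. \<bar>u * x\<bar> powr (- 1 - Y) * (1 - cos (u * x)))"
      using lborel_integral_real_affine[of u "\<lambda>x. \<bar>x\<bar> powr (- 1 - Y) * (1 - cos x)" 0] False 1 by simp
    also have "\<dots> = \<bar>u\<bar> * (\<bar>u\<bar> powr (- 1 - Y) * (LINT x|lborel. \<bar>x\<bar> powr (- 1 - Y) * (1 - cos (u * x))))"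
      by (simp add: abs_mult powr_mult mult.assoc)
    also have "\<dots> = \<bar>u\<bar> powr (- Y) * (LINT x|lborel. \<bar>x\<bar> powr (- 1 - Y) * (1 - cos (u * x)))"
      using powr_mult_base[of "\<bar>u\<bar>" "- 1 - Y"] by (simp add: mult.assoc[symmetric])
    finally show ?thesis using False by (simp add: c_def powr_minus field_simps)
  qed simp
qed

text \<open>Adding the reflected integrand cancels the sine and the compensator, leaving the
  integral of \<open>1 - cos (u * x)\<close>.\<close>

lemma stable_exponent:
  assumes Y: "1 < Y" "Y < 2"
  shows "(CLINT x|lborel. complex_of_real (\<bar>x\<bar> powr (- 1 - Y)) * compensated_iexp (u * x))
    = complex_of_real (- 2 * Gamma (- Y) * \<bar>cos (Y * pi / 2)\<bar> * \<bar>u\<bar> powr Y)"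
proof -
  define f where "f = (\<lambda>x. complex_of_real (\<bar>x\<bar> powr (- 1 - Y)) * compensated_iexp (u * x))"
  have f: "integrable lborel f"
    unfolding f_def using tempered_stable_integral(1)[OF Y, of "\<lambda>_. 1" u] by simp
  have f': "integrable lborel (\<lambda>x. f (- x))"
    using lborel_integrable_real_affine[OF f, of "- 1" 0] by simp
  have "integral\<^sup>L lborel f = (CLINT x|lborel. f (- x))"
    using lborel_integral_real_affine[of "- 1" f 0] by simp
  then have "2 * integral\<^sup>L lborel f = (CLINT x|lborel. f x + f (- x))"
    using f f' by simp
  also have "\<dots> = (CLINT x|lborel. complex_of_real (- 2 * (\<bar>x\<bar> powr (- 1 - Y) * (1 - cos (u * x)))))"
    by (intro Bochner_Integration.integral_cong refl)
       (auto simp: f_def compensated_iexp_def complex_eq_iff Re_exp Im_exp algebra_simps)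
  also have "\<dots> = 2 * complex_of_real (- (LINT x|lborel. \<bar>x\<bar> powr (- 1 - Y) * (1 - cos (u * x))))"
    by (subst integral_complex_of_real) simp
  finally show ?thesis
    unfolding f_def one_minus_cos_powr_integral[OF Y] by simp
qed

text \<open>After the substitution of \<open>h n * x\<close> for \<open>x\<close> all powers of
  \<open>h n\<close> cancel and only the tempering \<open>q (h n * x)\<close> still depends on
  \<open>n\<close>. It tends to 1 and is at most 1, so the untempered integrand dominates.\<close>

lemma tempered_stable_exponent_limit:
  fixes q :: "real \<Rightarrow> real" and h :: "nat \<Rightarrow> real"
  assumes Y: "1 < Y" "Y < 2"
    and q[measurable]: "q \<in> borel_measurable borel" and q01: "\<And>x. 0 \<le> q x" "\<And>x. q x \<le> 1"
    and h: "\<And>n. h n > 0" and lim: "\<And>x. (\<lambda>n. q (h n * x)) \<longlonglongrightarrow> 1"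
  shows "(\<lambda>n. complex_of_real (h n powr Y) *
      (CLINT x|lborel. complex_of_real (q x * \<bar>x\<bar> powr (- 1 - Y)) * compensated_iexp (u / h n * x)))
    \<longlonglongrightarrow> complex_of_real (- 2 * Gamma (- Y) * \<bar>cos (Y * pi / 2)\<bar> * \<bar>u\<bar> powr Y)"
proof -
  define f where "f = (\<lambda>x. complex_of_real (\<bar>x\<bar> powr (- 1 - Y)) * compensated_iexp (u * x))"
  have f: "integrable lborel f"
    unfolding f_def using tempered_stable_integral(1)[OF Y, of "\<lambda>_. 1" u] by simp
  have [measurable]: "f \<in> borel_measurable borel" unfolding f_def by measurable
  have "complex_of_real (h n powr Y) *
      (CLINT x|lborel. complex_of_real (q x * \<bar>x\<bar> powr (- 1 - Y)) * compensated_iexp (u / h n * x))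
    = (CLINT x|lborel. complex_of_real (q (h n * x)) * f x)" (is "?l = _") for n
  proof -
    have c: "h n powr Y * (h n * (h n powr (- 1 - Y))) = 1"
      using h[of n] by (simp add: powr_diff powr_minus field_simps)
    have scale: "\<bar>h n * x\<bar> powr (- 1 - Y) = h n powr (- 1 - Y) * \<bar>x\<bar> powr (- 1 - Y)" "u / h n * (h n * x) = u * x" for x
      using h[of n] by (auto simp: abs_mult powr_mult)
    have "?l = complex_of_real (h n powr Y) * (h n *\<^sub>R
       (CLINT x|lborel. complex_of_real (q (h n * x) * \<bar>h n * x\<bar> powr (- 1 - Y)) * compensated_iexp (u / h n * (h n * x))))"
      using h[of n] by (subst lborel_integral_real_affine[of "h n" _ 0]) auto
    also have "\<dots> = complex_of_real (h n powr Y) * (h n *\<^sub>R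
       (CLINT x|lborel. complex_of_real (h n powr (- 1 - Y)) * (complex_of_real (q (h n * x)) * f x)))"
      unfolding scale f_def by (simp only: of_real_mult mult_ac)
    also have "\<dots> = complex_of_real (h n powr Y * (h n * (h n powr (- 1 - Y)))) * (CLINT x|lborel. complex_of_real (q (h n * x)) * f x)"
      unfolding integral_mult_right_zero by (simp add: scaleR_conv_of_real)
    finally show ?thesis unfolding c by simp
  qed
  moreover have "(\<lambda>n. CLINT x|lborel. complex_of_real (q (h n * x)) * f x) \<longlonglongrightarrow> integral\<^sup>L lborel f"
  proof (rule integral_dominated_convergence[where w = "\<lambda>x. norm (f x)"])
    show "AE x in lborel. (\<lambda>n. complex_of_real (q (h n * x)) * f x) \<longlonglongrightarrow> f x"
    proof (intro AE_I2)
      fix x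
      have "(\<lambda>n. complex_of_real (q (h n * x)) * f x) \<longlonglongrightarrow> complex_of_real 1 * f x"
        by (rule tendsto_mult[OF tendsto_of_real[OF lim] tendsto_const])
      then show "(\<lambda>n. complex_of_real (q (h n * x)) * f x) \<longlonglongrightarrow> f x" by simp
    qed
    show "AE x in lborel. norm (complex_of_real (q (h n * x)) * f x) \<le> norm (f x)" for n
      using q01 by (auto simp: norm_mult intro!: mult_left_le_one_le)
  qed (use f in auto)
  moreover have "integral\<^sup>L lborel f = complex_of_real (- 2 * Gamma (- Y) * \<bar>cos (Y * pi / 2)\<bar> * \<bar>u\<bar> powr Y)"
    unfolding f_def by (rule stable_exponent[OF Y])
  ultimately show ?thesis by simp
qed

text \<open>The hypothesis places \<open>z\<close> in the closed left half-plane, a convex set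
  containing 0 on which the derivative of \<open>exp\<close> has norm at most 1.\<close>

lemma norm_one_minus_exp_le:
  fixes z :: complex
  assumes "norm (exp z) \<le> 1"
  shows "norm (1 - exp z) \<le> norm z"
proof -
  have "Re z \<le> 0" using assms by simp
  have "norm (exp z - exp 0) \<le> 1 * norm (z - 0)"
  proof (rule field_differentiable_bound[where S = "{w. Re w \<le> 0}" and f' = exp])
    show "convex {w. Re w \<le> 0}" by (rule convex_halfspace_Re_le)
  qed (use \<open>Re z \<le> 0\<close> in \<open>auto intro!: derivative_eq_intros\<close>)
  then show ?thesis by (simp add: norm_minus_commute)
qed

section \<open>Laws with given characteristic functions\<close>

lemma char_distr:
  assumes [measurable]: "f \<in> borel_measurable M"
  shows "char (distr M borel f) u = (CLINT \<omega>|M. iexp (u * f \<omega>))"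
  unfolding char_def by (subst integral_distr) auto

text \<open>Reflection flips the argument of the characteristic function, so evenness and Levy's
  uniqueness theorem give symmetry of the law.\<close>

lemma distr_uminus_eq:
  assumes "real_distribution \<mu>" and "\<And>u. char \<mu> (- u) = char \<mu> u"
  shows "distr \<mu> borel uminus = \<mu>"
proof -
  interpret real_distribution \<mu> by fact
  have "char (distr \<mu> borel uminus) = char \<mu>"
  proof
    fix u
    have "char (distr \<mu> borel uminus) u = char \<mu> (- u)"
      by (subst char_distr) (auto simp: char_def)
    then show "char (distr \<mu> borel uminus) u = char \<mu> u" using assms(2) by simp
  qed
  then show ?thesis
    by (intro Levy_uniqueness real_distribution_distr) (auto intro: assms)
qed

text \<open>Weak convergence follows from Levy's continuity theorem, since the jump part of the
  exponent has the stable limit and the drift vanishes. The tail estimate is the Gaussian averaging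
  bound at scale \<open>1 / y\<close>.\<close>

lemma rescaled_tempered_stable:
  fixes q :: "real \<Rightarrow> real" and h :: "nat \<Rightarrow> real" and \<mu> :: "nat \<Rightarrow> real measure"
  defines "\<psi> \<equiv> \<lambda>d C Y u. \<i> * complex_of_real (d * u)
      + complex_of_real C * (CLINT x|lborel. complex_of_real (q x * \<bar>x\<bar> powr (- 1 - Y)) * compensated_iexp (u * x))"
  assumes Y: "1 < Y" "Y < 2" and "0 \<le> C"
    and q: "q \<in> borel_measurable borel" "\<And>x. 0 \<le> q x" "\<And>x. q x \<le> 1"
    and h: "\<And>n. h n > 0" "h \<longlonglongrightarrow> 0" and lim: "\<And>x. (\<lambda>n. q (h n * x)) \<longlonglongrightarrow> 1"
    and \<mu>: "\<And>n. real_distribution (\<mu> n)"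
    and char_\<mu>: "\<And>n u. char (\<mu> n) u = exp (complex_of_real (h n powr Y) * \<psi> d C Y (u / h n))"
    and \<mu>': "real_distribution \<mu>'"
    and char_\<mu>': "\<And>u. char \<mu>' u = complex_of_real (exp (- 2 * C * Gamma (- Y) * \<bar>cos (Y * pi / 2)\<bar> * \<bar>u\<bar> powr Y))"
  shows "weak_conv_m \<mu> \<mu>'"
    and "\<exists>A\<ge>0. \<forall>n y. 0 < y \<longrightarrow> y * h n < 1 \<longrightarrow> measure (\<mu> n) {x. y \<le> \<bar>x\<bar>} \<le> A * y powr (- Y)"
proof -
  define T where "T = (\<lambda>u. CLINT x|lborel. complex_of_real (q x * \<bar>x\<bar> powr (- 1 - Y)) * compensated_iexp (u * x))"
  have \<psi>: "\<psi> d C Y u = \<i> * complex_of_real (d * u) + complex_of_real C * T u" for u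
    by (simp add: \<psi>_def T_def)
  \<comment> \<open>Scaling leaves the factor \<open>h n powr (Y - 1)\<close> on the drift, which
    tends to 0 because \<open>1 < Y\<close>.\<close>
  have drift: "complex_of_real (h n powr Y) * (\<i> * complex_of_real (d * (u / h n)))
      = \<i> * complex_of_real (h n powr (Y - 1) * (d * u))" for n u
    using h(1)[of n] by (simp add: powr_diff)
  show "weak_conv_m \<mu> \<mu>'"
  proof (rule levy_continuity[OF \<mu> \<mu>'])
    fix u
    have "(\<lambda>n. h n powr (Y - 1)) \<longlonglongrightarrow> 0"
      using Y h by (intro tendsto_zero_powrI[OF h(2) tendsto_const]) (auto intro!: always_eventually less_imp_le)
    from tendsto_mult_left[OF tendsto_of_real[OF tendsto_mult_right[OF this, of "d * u"]], of \<i>]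
    have "(\<lambda>n. \<i> * complex_of_real (h n powr (Y - 1) * (d * u))) \<longlonglongrightarrow> 0" by simp
    moreover have "(\<lambda>n. complex_of_real C * (complex_of_real (h n powr Y) * T (u / h n))) \<longlonglongrightarrow>
        complex_of_real C * complex_of_real (- 2 * Gamma (- Y) * \<bar>cos (Y * pi / 2)\<bar> * \<bar>u\<bar> powr Y)"
      unfolding T_def by (intro tendsto_mult_left tempered_stable_exponent_limit[OF Y q h(1) lim])
    ultimately have "(\<lambda>n. exp (\<i> * complex_of_real (h n powr (Y - 1) * (d * u))
          + complex_of_real C * (complex_of_real (h n powr Y) * T (u / h n)))) \<longlonglongrightarrow>
        exp (0 + complex_of_real C * complex_of_real (- 2 * Gamma (- Y) * \<bar>cos (Y * pi / 2)\<bar> * \<bar>u\<bar> powr Y))"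
      by (intro tendsto_exp tendsto_add)
    moreover have "exp (\<i> * complex_of_real (h n powr (Y - 1) * (d * u))
          + complex_of_real C * (complex_of_real (h n powr Y) * T (u / h n))) = char (\<mu> n) u" for n
      unfolding char_\<mu> \<psi> distrib_left drift by (simp only: mult_ac)
    moreover have "exp (0 + complex_of_real C * complex_of_real (- 2 * Gamma (- Y) * \<bar>cos (Y * pi / 2)\<bar> * \<bar>u\<bar> powr Y)) = char \<mu>' u"
      unfolding char_\<mu>' exp_of_real[symmetric] add_0_left of_real_mult[symmetric] by (simp add: mult_ac)
    ultimately show "(\<lambda>n. char (\<mu> n) u) \<longlonglongrightarrow> char \<mu>' u" by simp
  qed
  define B where "B = C * (2 * (LINT x|lborel. stable_majorant Y x))"
  have B: "0 \<le> B" unfolding B_def using \<open>0 \<le> C\<close> by (simp add: stable_majorant_nonneg)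
  have T: "C * norm (T u) \<le> B * \<bar>u\<bar> powr Y" for u
    using mult_left_mono[OF tempered_stable_integral(2)[OF Y q, of u] \<open>0 \<le> C\<close>]
    unfolding B_def T_def by (simp add: mult_ac)
  show "\<exists>A\<ge>0. \<forall>n y. 0 < y \<longrightarrow> y * h n < 1 \<longrightarrow> measure (\<mu> n) {x. y \<le> \<bar>x\<bar>} \<le> A * y powr (- Y)"
  proof (intro exI[of _ "6 * (\<bar>d\<bar> + B)"] conjI allI impI)
    fix n y assume y: "0 < y" "y * h n < 1"
    interpret real_distribution "\<mu> n" by (rule \<mu>)
    \<comment> \<open>The stable part of this bound is uniform in \<open>n\<close>, because
      \<open>h n powr Y\<close> cancels the scaling of
      \<open>\<bar>u / h n\<bar> powr Y\<close>.\<close>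
    have bound: "norm (1 - char (\<mu> n) u) \<le> (\<bar>d\<bar> * h n powr (Y - 1)) * \<bar>u\<bar> + B * \<bar>u\<bar> powr Y" for u
    proof -
      have "norm (1 - char (\<mu> n) u) \<le> norm (complex_of_real (h n powr Y) * \<psi> d C Y (u / h n))"
        using cmod_char_le_1[of u] unfolding char_\<mu> by (rule norm_one_minus_exp_le)
      also have "\<dots> \<le> norm (\<i> * complex_of_real (h n powr (Y - 1) * (d * u)))
          + norm (complex_of_real (h n powr Y) * (complex_of_real C * T (u / h n)))"
        unfolding \<psi> distrib_left drift by (rule norm_triangle_ineq)
      also have "\<dots> = (\<bar>d\<bar> * h n powr (Y - 1)) * \<bar>u\<bar> + h n powr Y * (C * norm (T (u / h n)))"
        using \<open>0 \<le> C\<close> by (simp add: norm_mult abs_mult)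
      also have "\<dots> \<le> (\<bar>d\<bar> * h n powr (Y - 1)) * \<bar>u\<bar> + h n powr Y * (B * \<bar>u / h n\<bar> powr Y)"
        by (intro add_left_mono mult_left_mono T) auto
      also have "h n powr Y * (B * \<bar>u / h n\<bar> powr Y) = B * \<bar>u\<bar> powr Y"
        using h(1)[of n] by (simp add: powr_divide)
      finally show ?thesis .
    qed
    have "measure (\<mu> n) {x. y \<le> \<bar>x\<bar>} = measure (\<mu> n) {x. 1 \<le> 1 / y * \<bar>x\<bar>}"
      using y by (simp add: field_simps)
    also have "\<dots> \<le> 6 * (\<bar>d\<bar> * h n powr (Y - 1) * (1 / y) + B * (1 / y) powr Y)"
      using Y y B by (intro real_distribution_tail_bound[OF \<mu> bound]) auto
    \<comment> \<open>Since \<open>h n < 1 / y\<close>, the drift term too is of order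
      \<open>y powr (- Y)\<close>.\<close>
    also have "\<dots> \<le> 6 * (\<bar>d\<bar> * (1 / y) powr (Y - 1) * (1 / y) + B * (1 / y) powr Y)"
      using y h(1)[of n] Y
      by (intro mult_left_mono add_right_mono mult_right_mono powr_mono2) (auto simp: field_simps)
    also have "\<bar>d\<bar> * (1 / y) powr (Y - 1) * (1 / y) = \<bar>d\<bar> * (1 / y) powr Y"
      using y by (simp add: powr_diff)
    also have "(1 / y) powr Y = y powr (- Y)"
      using y by (simp add: powr_minus powr_divide field_simps)
    finally show "measure (\<mu> n) {x. y \<le> \<bar>x\<bar>} \<le> 6 * (\<bar>d\<bar> + B) * y powr (- Y)"
      by (simp add: algebra_simps)
  qed (use B in simp)
qed

subsection \<open>The option price\<close>

lemma martingale_expectation: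
  assumes "prob_space P" "martingale P F S" "0 \<le> t"
  shows "integral\<^sup>L P (S t) = integral\<^sup>L P (S 0)"
proof -
  interpret prob_space P by fact
  have sub: "subalgebra P (F 0)" and int: "integrable P (S t)" "S 0 \<in> borel_measurable P"
    and ce: "AE \<omega> in P. real_cond_exp P (F 0) (S t) \<omega> = S 0 \<omega>"
    using assms unfolding martingale_def by auto
  interpret finite_measure_subalgebra P "F 0" by unfold_locales (rule sub)
  have "integral\<^sup>L P (S t) = integral\<^sup>L P (real_cond_exp P (F 0) (S t))"
    using real_cond_exp_int(2)[OF int(1)] by simp
  also have "\<dots> = integral\<^sup>L P (S 0)"
    by (rule integral_cong_AE) (use ce int in auto)
  finally show ?thesis .
qed

text \<open>The two payoffs differ by \<open>S \<omega> - K\<close>, which has mean 0.\<close>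

lemma put_call_parity:
  fixes S :: "'a \<Rightarrow> real"
  assumes "prob_space P" "integrable P S" "integral\<^sup>L P S = K" "\<And>\<omega>. 0 \<le> S \<omega>"
  shows "(LINT \<omega>|P. max (S \<omega> - K) 0) = (LINT \<omega>|P. max (K - S \<omega>) 0)"
proof -
  interpret prob_space P by fact
  have put: "integrable P (\<lambda>\<omega>. max (K - S \<omega>) 0)"
    using assms by (intro integrable_max) auto
  have "(LINT \<omega>|P. max (S \<omega> - K) 0) = (LINT \<omega>|P. (S \<omega> - K) + max (K - S \<omega>) 0)"
    by (intro Bochner_Integration.integral_cong) (auto simp: max_def)
  also have "\<dots> = (LINT \<omega>|P. max (K - S \<omega>) 0)"
    using put assms prob_space by simp
  finally show ?thesis .
qed

theorem proposition4p2:
  fixes P :: "'a measure" and Pstar :: "'b measure"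
    and F :: "real \<Rightarrow> 'a measure"
    and X S :: "real \<Rightarrow> 'a \<Rightarrow> real"
    and Z :: "'b \<Rightarrow> real"
    and C G M Y S0 :: real
  assumes "C > 0" and "G > 0" and "M > 1" and "1 < Y" and "Y < 2" and "S0 > 0"
    and "cgmy_process P C G M Y X"
    and "\<And>t \<omega>. S t \<omega> = S0 * exp (X t \<omega>)"
    and "martingale P F S"
    and "prob_space Pstar" and "Z \<in> borel_measurable Pstar"
    and "\<And>u. char (distr Pstar borel Z) u =
           complex_of_real (exp (- 2 * C * Gamma (- Y) * \<bar>cos (Y * pi / 2)\<bar> * \<bar>u\<bar> powr Y))"
  shows "integrable Pstar (\<lambda>\<omega>. max (Z \<omega>) 0) \<and>
    ((\<lambda>t. t powr (- 1 / Y) * integral\<^sup>L P (\<lambda>\<omega>. max (S t \<omega> - S0) 0))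
      \<longlongrightarrow> S0 * integral\<^sup>L Pstar (\<lambda>\<omega>. max (Z \<omega>) 0)) (at_right 0)"
proof -
  note Y = \<open>1 < Y\<close> \<open>Y < 2\<close>
  define \<mu>' where "\<mu>' = distr Pstar borel Z"
  have [measurable]: "Z \<in> borel_measurable Pstar" by fact
  have \<mu>': "real_distribution \<mu>'"
    unfolding \<mu>'_def using assms by (intro prob_space.real_distribution_distr) auto
  have symm: "distr \<mu>' borel uminus = \<mu>'"
    using \<mu>' by (rule distr_uminus_eq) (simp add: \<mu>'_def assms)
  obtain b where levy: "levy_process P X"
    and trip: "has_levy_triplet P X b 0 (density lborel (\<lambda>x. ennreal (cgmy_density C G M Y x)))"
    using \<open>cgmy_process P C G M Y X\<close> unfolding cgmy_process_def by auto
  have P: "prob_space P" and X: "\<And>t. 0 \<le> t \<Longrightarrow> X t \<in> borel_measurable P"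
    and X0: "AE \<omega> in P. X 0 \<omega> = 0"
    using levy unfolding levy_process_def by auto
  interpret prob_space P by fact
  define q where "q = (\<lambda>x. if 0 < x then exp (- M * x) else exp (G * x))"
  have q: "q \<in> borel_measurable borel" "\<And>x. 0 \<le> q x" "\<And>x. q x \<le> 1"
    using assms by (auto simp: q_def mult_nonneg_nonpos)
  \<comment> \<open>At \<open>x = 0\<close> both sides vanish, because a \<open>powr\<close> with
    base 0 is 0.\<close>
  have dens: "cgmy_density C G M Y x = C * (q x * \<bar>x\<bar> powr (- 1 - Y))" for x
    by (simp add: cgmy_density_def q_def)
  obtain d where d: "\<And>u. levy_exponent b 0 (density lborel (\<lambda>x. ennreal (C * (q x * \<bar>x\<bar> powr (- 1 - Y))))) u
    = \<i> * complex_of_real (d * u)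
      + complex_of_real C * (CLINT x|lborel. complex_of_real (q x * \<bar>x\<bar> powr (- 1 - Y)) * compensated_iexp (u * x))"
    using levy_exponent_tempered_stable[OF Y less_imp_le[OF \<open>C > 0\<close>] q, of b] by blast
  have int: "integrable P (S t)" if "0 \<le> t" for t
    using \<open>martingale P F S\<close> that by (simp add: martingale_def)
  have mean: "integral\<^sup>L P (S t) = S0" if "0 \<le> t" for t
  proof -
    have "integral\<^sup>L P (S t) = integral\<^sup>L P (S 0)"
      by (rule martingale_expectation[OF P \<open>martingale P F S\<close> that])
    also have "\<dots> = (LINT \<omega>|P. S0)"
      by (rule integral_cong_AE) (use int[of 0] X0 in \<open>auto simp: assms(8)\<close>)
    finally show ?thesis by (simp add: prob_space)
  qed
  define g where "g = (\<lambda>t. t powr (- 1 / Y) * integral\<^sup>L P (\<lambda>\<omega>. max (S t \<omega> - S0) 0))"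
  \<comment> \<open>The limit at \<open>0+\<close> is tested along positive null sequences, the form
    in which the weak convergence results apply.\<close>
  have seq: "integrable \<mu>' (\<lambda>x. max (- x) 0) \<and> (\<lambda>n. g (t n)) \<longlonglongrightarrow> S0 * (LINT x|\<mu>'. max (- x) 0)"
    if t: "\<And>n. 0 < t n" "t \<longlonglongrightarrow> 0" for t :: "nat \<Rightarrow> real"
  proof -
    define h where "h = (\<lambda>n. t n powr (1 / Y))"
    have h: "h n > 0" "h \<longlonglongrightarrow> 0" for n
    proof -
      show "h n > 0" using t(1)[of n] by (simp add: h_def)
      show "h \<longlonglongrightarrow> 0"
        unfolding h_def using t Y
        by (intro tendsto_zero_powrI[OF t(2) tendsto_const]) (auto intro!: always_eventually less_imp_le)
    qed
    have hY: "h n powr Y = t n" for n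
      using t(1)[of n] Y by (simp add: h_def powr_powr)
    have [measurable]: "X (t n) \<in> borel_measurable P" for n
      using X t(1) by (simp add: less_imp_le)
    define \<mu> where "\<mu> = (\<lambda>n. distr P borel (\<lambda>\<omega>. X (t n) \<omega> / h n))"
    have \<mu>: "real_distribution (\<mu> n)" for n
      unfolding \<mu>_def by (rule real_distribution_distr) measurable
    have char_\<mu>: "char (\<mu> n) u = exp (complex_of_real (h n powr Y) *
       (\<i> * complex_of_real (d * (u / h n))
      + complex_of_real C * (CLINT x|lborel. complex_of_real (q x * \<bar>x\<bar> powr (- 1 - Y)) * compensated_iexp (u / h n * x))))" for n u
    proof -
      \<comment> \<open>Dividing \<open>X (t n)\<close> by \<open>h n\<close> rescales the argument,
        and \<open>h n powr Y = t n\<close> supplies the time factor in the exponent.\<close>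
      have "char (\<mu> n) u = char (distr P borel (X (t n))) (u / h n)"
        unfolding \<mu>_def by (subst (1 2) char_distr) auto
      also have "\<dots> = exp (complex_of_real (t n) *
          levy_exponent b 0 (density lborel (\<lambda>x. ennreal (C * (q x * \<bar>x\<bar> powr (- 1 - Y))))) (u / h n))"
        using trip t(1)[of n] unfolding has_levy_triplet_def dens by (simp add: less_imp_le)
      finally show ?thesis unfolding d hY .
    qed
    have lim: "(\<lambda>n. q (h n * x)) \<longlonglongrightarrow> 1" for x
    proof (cases "0 < x")
      case True
      then have "q (h n * x) = exp (- M * (h n * x))" for n using h(1)[of n] by (simp add: q_def)
      moreover have "(\<lambda>n. exp (- M * (h n * x))) \<longlonglongrightarrow> exp (- M * (0 * x))" by (intro tendsto_intros h)
      ultimately show ?thesis by simp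
    next
      case False
      then have "q (h n * x) = exp (G * (h n * x))" for n
        using h(1)[of n] by (simp add: q_def zero_less_mult_iff)
      moreover have "(\<lambda>n. exp (G * (h n * x))) \<longlonglongrightarrow> exp (G * (0 * x))" by (intro tendsto_intros h)
      ultimately show ?thesis by simp
    qed
    note R = rescaled_tempered_stable[OF Y less_imp_le[OF \<open>C > 0\<close>] q h lim \<mu> char_\<mu> \<mu>' assms(12)[folded \<mu>'_def]]
    obtain A where A: "0 \<le> A" "\<And>n y. \<lbrakk>0 < y; y * h n < 1\<rbrakk> \<Longrightarrow> measure (\<mu> n) {x. y \<le> \<bar>x\<bar>} \<le> A * y powr (- Y)"
      using R(2) by blast
    note L = weak_conv_integral_rescaled_put[OF \<mu> \<mu>' R(1) h A(2) A(1) Y(1)]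
    \<comment> \<open>The call is exchanged for the put by parity; the factor \<open>S0\<close>
      comes out of the payoff, and the time normalization equals \<open>1 / h n\<close>.\<close>
    have "g (t n) = S0 * (LINT x|\<mu> n. max (1 - exp (h n * x)) 0 / h n)" for n
    proof -
      have "t n powr (- 1 / Y) = 1 / h n"
        by (simp add: h_def powr_minus_divide)
      moreover have "integral\<^sup>L P (\<lambda>\<omega>. max (S (t n) \<omega> - S0) 0) = (LINT \<omega>|P. max (S0 - S (t n) \<omega>) 0)"
        using t(1)[of n] assms(6,8)
        by (intro put_call_parity[OF P int mean]) (auto intro: less_imp_le)
      moreover have "\<dots> = (LINT \<omega>|P. S0 * max (1 - exp (X (t n) \<omega>)) 0)"
        using \<open>S0 > 0\<close> by (intro Bochner_Integration.integral_cong) (auto simp: assms(8) max_def algebra_simps)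
      moreover have "(LINT x|\<mu> n. max (1 - exp (h n * x)) 0 / h n) = (LINT \<omega>|P. max (1 - exp (X (t n) \<omega>)) 0) / h n"
        unfolding \<mu>_def using h(1)[of n] less_imp_neq[OF h(1)[of n]] by (subst integral_distr) auto
      ultimately show ?thesis by (auto simp: g_def)
    qed
    then show ?thesis using L tendsto_mult_left[OF L(2), of S0] by simp
  qed
  \<comment> \<open>Symmetry of the stable law turns the negative part produced by the put into the
    positive part of \<open>Z\<close>.\<close>
  have flip: "(LINT x|\<mu>'. max (- x) 0) = (LINT \<omega>|Pstar. max (Z \<omega>) 0)"
      "integrable \<mu>' (\<lambda>x. max (- x) 0) \<longleftrightarrow> integrable Pstar (\<lambda>\<omega>. max (Z \<omega>) 0)"
  proof -
    have "(LINT x|\<mu>'. max (- x) 0) = (LINT x|distr \<mu>' borel uminus. max x 0)"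
      by (subst integral_distr) (auto simp: \<mu>'_def)
    also have "\<dots> = (LINT \<omega>|Pstar. max (Z \<omega>) 0)"
      unfolding symm unfolding \<mu>'_def by (subst integral_distr) auto
    finally show "(LINT x|\<mu>'. max (- x) 0) = (LINT \<omega>|Pstar. max (Z \<omega>) 0)" .
    have "integrable \<mu>' (\<lambda>x. max (- x) 0) \<longleftrightarrow> integrable (distr \<mu>' borel uminus) (\<lambda>x. max x 0)"
      by (subst integrable_distr_eq) (auto simp: \<mu>'_def)
    also have "\<dots> \<longleftrightarrow> integrable Pstar (\<lambda>\<omega>. max (Z \<omega>) 0)"
      unfolding symm unfolding \<mu>'_def by (subst integrable_distr_eq) auto
    finally show "integrable \<mu>' (\<lambda>x. max (- x) 0) \<longleftrightarrow> integrable Pstar (\<lambda>\<omega>. max (Z \<omega>) 0)" .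
  qed
  have "integrable Pstar (\<lambda>\<omega>. max (Z \<omega>) 0)"
    \<comment> \<open>Integrability does not mention the sequence, so a single null sequence
      suffices.\<close>
    using seq[of "\<lambda>n. 1 / real (Suc n)"] LIMSEQ_Suc[OF lim_1_over_n] flip by auto
  moreover have "(g \<longlongrightarrow> S0 * (LINT \<omega>|Pstar. max (Z \<omega>) 0)) (at_right 0)"
    by (rule tendsto_at_right_sequentially[of 0 1]) (use seq flip in auto)
  ultimately show ?thesis unfolding g_def by blast
qed

end
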